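(* Let $\Delta$ be a finite simplicial complex whose $h$-vector is nonnegative and symmetric. Then the $\gamma$-vector of the interval subdivision $\mathrm{Int}(\Delta)$ is the $f$-vector of some balanced simplicial complex.
   Context: For a $(d-1)$-dimensional simplicial complex $\Delta$ let $f_i$ be the number of faces with $i$ elements ($f_0=1$ for the empty face), $f_\Delta(t)=\sum_{i=0}^d f_i t^i$, and define the $h$-polynomial $h_\Delta(t)=(1-t)^d f_\Delta(t/(1-t))=\sum_{i=0}^d h_i t^i$; $h(\Delta)=(h_0,\dots,h_d)$ is the $h$-vector. It is symmetric if $h_i=h_{d-i}$ for all $i$; in that case there are unique integers $\gamma_i$ with $h_\Delta(t)=\sum_{i=0}^{\lfloor d/2\rfloor}\gamma_i t^i(1+t)^{d-2i}$, and $\gamma(\Delta)=(\gamma_0,\dots,\gamma_{\lfloor d/2\rfloor})$ is the $\gamma$-vector. The interval subdivision $\mathrm{Int}(\Delta)$ is the order complex (simplicial complex of all chains) of the poset $\{[A,B]:\emptyset\neq A\subseteq B\in\Delta\}$ ordered by $[A,B]\le[A',B']$ iff $A'\subseteq A\subseteq B\subseteq B'$; it is a subdivision of $\Delta$ of the same dimension. A $(k-1)$-dimensional simplicial complex is balanced if its vertices can be colored with $k$ colors so that the vertices of every face receive distinct colors. *)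

theory Defs
  imports "HOL-Computational_Algebra.Polynomial"
begin

definition simplicial_complex :: "'a set set \<Rightarrow> bool" where
  "simplicial_complex \<Delta> \<longleftrightarrow> finite \<Delta> \<and> {} \<in> \<Delta> \<and> (\<forall>F\<in>\<Delta>. finite F) \<and>
     (\<forall>F\<in>\<Delta>. \<forall>G. G \<subseteq> F \<longrightarrow> G \<in> \<Delta>)"

text \<open>d = maximal face size, so that the complex is (d-1)-dimensional.\<close>
definition cdim :: "'a set set \<Rightarrow> nat" where
  "cdim \<Delta> = Max (card ` \<Delta>)"

definition fnum :: "'a set set \<Rightarrow> nat \<Rightarrow> nat" where
  "fnum \<Delta> i = card {F \<in> \<Delta>. card F = i}"

text \<open>h(t) = (1-t)^d f(t/(1-t)) = sum_j f_j t^j (1-t)^(d-j).\<close>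
definition h_poly :: "'a set set \<Rightarrow> int poly" where
  "h_poly \<Delta> = (\<Sum>j\<le>cdim \<Delta>. smult (int (fnum \<Delta> j)) (monom 1 j * [:1, -1:] ^ (cdim \<Delta> - j)))"

definition h_vec :: "'a set set \<Rightarrow> nat \<Rightarrow> int" where
  "h_vec \<Delta> i = coeff (h_poly \<Delta>) i"

definition h_symmetric :: "'a set set \<Rightarrow> bool" where
  "h_symmetric \<Delta> \<longleftrightarrow> (\<forall>i\<le>cdim \<Delta>. h_vec \<Delta> i = h_vec \<Delta> (cdim \<Delta> - i))"

definition h_nonneg :: "'a set set \<Rightarrow> bool" where
  "h_nonneg \<Delta> \<longleftrightarrow> (\<forall>i\<le>cdim \<Delta>. h_vec \<Delta> i \<ge> 0)"

text \<open>g is the gamma-vector of Delta: h(t) = sum_{i<=d/2} g_i t^i (1+t)^(d-2i)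
  (such g is unique when it exists).\<close>
definition is_gamma_vector :: "'a set set \<Rightarrow> (nat \<Rightarrow> int) \<Rightarrow> bool" where
  "is_gamma_vector \<Delta> g \<longleftrightarrow>
     h_poly \<Delta> = (\<Sum>i\<le>cdim \<Delta> div 2. smult (g i) (monom 1 i * [:1, 1:] ^ (cdim \<Delta> - 2 * i)))"

definition balanced :: "'a set set \<Rightarrow> bool" where
  "balanced \<Delta> \<longleftrightarrow> (\<exists>\<kappa> :: 'a \<Rightarrow> nat.
     (\<forall>F\<in>\<Delta>. \<forall>v\<in>F. \<kappa> v < cdim \<Delta>) \<and> (\<forall>F\<in>\<Delta>. inj_on \<kappa> F))"

definition interval_poset :: "'a set set \<Rightarrow> ('a set \<times> 'a set) set" where
  "interval_poset \<Delta> = {(A, B). A \<noteq> {} \<and> A \<subseteq> B \<and> B \<in> \<Delta>}"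

definition int_le :: "('a set \<times> 'a set) \<Rightarrow> ('a set \<times> 'a set) \<Rightarrow> bool" where
  "int_le I J \<longleftrightarrow> fst J \<subseteq> fst I \<and> snd I \<subseteq> snd J"

definition interval_subdivision :: "'a set set \<Rightarrow> ('a set \<times> 'a set) set set" where
  "interval_subdivision \<Delta> = {C. finite C \<and> C \<subseteq> interval_poset \<Delta> \<and>
      (\<forall>I\<in>C. \<forall>J\<in>C. int_le I J \<or> int_le J I)}"

end

theory Submission
  imports Defs "HOL-Library.Countable"
begin

text \<open>
  Writing the face count of \<open>\<Delta>\<close> as \<open>\<phi>(x) = \<Sum> h\<^sub>l x\<^sup>l (1 + x)\<^bsup>d-l\<^esup>\<close>, multichains of intervals of length \<open>m\<close> are counted by
  \<open>\<phi>(2m) - \<phi>(2m-1)\<close>. Hence, with \<open>h\<^sub>b(s) = \<Sum> h\<^sub>l A\<^bsub>d,l\<^esub>(s)\<close> and the restricted Eulerian polynomials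
  \<open>A\<^bsub>d,l\<^esub>(s) = (1 - s)\<^bsup>d+1\<^esup> \<Sum> n\<^sup>l (n + 1)\<^bsup>d-l\<^esup> s\<^sup>n\<close> (so \<open>h\<^sub>b\<close> is the \<open>h\<close>-polynomial of the barycentric
  subdivision), the \<open>h\<close>-polynomial of the interval subdivision at \<open>s\<^sup>2\<close> is the even part of \<open>(1 + s)\<^sup>d h\<^sub>b(s)\<close>.

  Since \<open>h\<close> is symmetric, \<open>A\<^bsub>d,l\<^esub>\<close> and \<open>A\<^bsub>d,d-l\<^esub>\<close> occur with the same coefficient. The sums \<open>A\<^bsub>d,l\<^esub> + A\<^bsub>d,d-l\<^esub>\<close> and
  \<open>s A\<^bsub>d,l\<^esub> + A\<^bsub>d,d-l\<^esub>\<close> satisfy a mutual recursion without subtractions. It is mirrored by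
  complexes with \<open>d\<close> colours that grow by adding, in a new colour, vertices whose links are
  subcomplexes of the previous complex; so \<open>(1 + s)\<^sup>d h\<^sub>b(s) = (1 + s\<^sup>2)\<^sup>d f\<^sub>K(s / (1 + s\<^sup>2))\<close> for a complex \<open>K\<close>
  with a proper \<open>d\<close>-colouring.
  The even part of \<open>f\<^sub>K\<close> is the \<open>f\<close>-polynomial of the complex obtained by sorting every face of even
  size by colour and pairing consecutive vertices; the pair \<open>(a, b)\<close> gets half the colour of \<open>a\<close>.
\<close>

section \<open>Face polynomials and \<open>h\<close>-polynomials\<close>

lemma map_of_int_poly_add: "map_poly real_of_int (p + q) = map_poly real_of_int p + map_poly real_of_int q"
  by (rule poly_eqI) (simp add: coeff_map_poly)

lemma map_of_int_poly_mult: "map_poly real_of_int (p * q) = map_poly real_of_int p * map_poly real_of_int q"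
  by (rule poly_eqI) (simp add: coeff_map_poly coeff_mult)

lemma map_of_int_poly_sum:
  "map_poly real_of_int (\<Sum>i\<in>I. p i) = (\<Sum>i\<in>I. map_poly real_of_int (p i))"
  by (induction I rule: infinite_finite_induct) (simp_all add: map_of_int_poly_add)

lemma map_of_int_poly_power: "map_poly real_of_int (p ^ n) = map_poly real_of_int p ^ n"
  by (induction n) (simp_all add: map_of_int_poly_mult)

lemma real_poly_eqI:
  fixes p q :: "real poly"
  assumes "\<And>x. 0 < x \<Longrightarrow> x < 1 \<Longrightarrow> poly p x = poly q x"
  shows "p = q"
proof (rule ccontr)
  assume "p \<noteq> q"
  then have "finite {x. poly (p - q) x = 0}"
    by (intro poly_roots_finite) simp
  moreover have "{0<..<1} \<subseteq> {x. poly (p - q) x = 0}"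
    using assms by auto
  ultimately have "finite {0<..<1::real}"
    by (rule rev_finite_subset)
  then show False
    by (simp add: infinite_Ioo)
qed

text \<open>The f-polynomial as a real function, so that it can be evaluated at quotients such as
  \<open>t / (1 - t)\<close>.\<close>

definition face_sum :: "'a set set \<Rightarrow> real \<Rightarrow> real" where
  "face_sum K x = (\<Sum>F\<in>K. x ^ card F)"

lemma face_sum_fnum:
  assumes "finite K" "\<And>F. F \<in> K \<Longrightarrow> card F \<le> m"
  shows "face_sum K x = (\<Sum>j\<le>m. real (fnum K j) * x ^ j)"
proof -
  have "face_sum K x = (\<Sum>j\<le>m. \<Sum>F\<in>{F\<in>K. card F = j}. x ^ card F)"
    unfolding face_sum_def using assms by (intro sum.group[symmetric]) auto
  also have "\<dots> = (\<Sum>j\<le>m. real (fnum K j) * x ^ j)"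
    by (rule sum.cong) (auto simp: fnum_def)
  finally show ?thesis .
qed

lemma card_le_cdim: "finite K \<Longrightarrow> F \<in> K \<Longrightarrow> card F \<le> cdim K"
  by (simp add: cdim_def)

lemma homogenize_sum:
  fixes y :: real
  assumes "y \<noteq> 0"
  shows "(\<Sum>j\<le>d. c j * (t ^ j * y ^ (d - j))) = y ^ d * (\<Sum>j\<le>d. c j * (t / y) ^ j)"
  unfolding sum_distrib_left
  by (rule sum.cong) (auto simp: assms power_divide power_diff)

lemma poly_h_poly:
  assumes "finite K" "t \<noteq> 1"
  shows "poly (map_poly real_of_int (h_poly K)) t = (1 - t) ^ cdim K * face_sum K (t / (1 - t))"
proof -
  have "poly (map_poly real_of_int (h_poly K)) t
      = (\<Sum>j\<le>cdim K. real (fnum K j) * (t ^ j * (1 - t) ^ (cdim K - j)))"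
    unfolding h_poly_def
    by (simp add: map_of_int_poly_sum map_of_int_poly_mult map_of_int_poly_power map_poly_smult
        map_poly_monom map_poly_pCons poly_sum poly_monom algebra_simps)
  also have "\<dots> = (1 - t) ^ cdim K * (\<Sum>j\<le>cdim K. real (fnum K j) * (t / (1 - t)) ^ j)"
    using assms by (intro homogenize_sum) auto
  finally show ?thesis
    using assms by (simp add: face_sum_fnum[OF _ card_le_cdim])
qed

lemma degree_h_poly: "degree (h_poly K) \<le> cdim K"
  unfolding h_poly_def
proof (rule degree_sum_le)
  fix j assume j: "j \<in> {..cdim K}"
  have "degree (monom 1 j * [:1, -1:] ^ (cdim K - j) :: int poly) \<le> j + (cdim K - j)"
    by (rule order_trans[OF degree_mult_le add_mono])
       (auto intro: degree_monom_le order_trans[OF degree_power_le])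
  then show "degree (smult (int (fnum K j)) (monom 1 j * [:1, - 1:] ^ (cdim K - j))) \<le> cdim K"
    using j degree_smult_le order_trans by fastforce
qed simp

lemma poly_map_h_poly:
  "poly (map_poly real_of_int (h_poly K)) t = (\<Sum>l\<le>cdim K. of_int (h_vec K l) * t ^ l)"
proof -
  have "degree (map_poly real_of_int (h_poly K)) \<le> cdim K"
    using degree_h_poly map_poly_degree_leq order_trans by blast
  then have "poly (map_poly real_of_int (h_poly K)) t
      = (\<Sum>l\<le>cdim K. coeff (map_poly real_of_int (h_poly K)) l * t ^ l)"
    unfolding poly_altdef by (intro sum.mono_neutral_left) (auto simp: coeff_eq_0)
  then show ?thesis
    by (simp add: coeff_map_poly h_vec_def)
qed

text \<open>Inverts the substitution in \<open>poly_h_poly\<close>: for t = x/(1 + x) one has 1 - t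
  = 1/(1 + x) and t/(1 - t) = x. The h-vector thus lists the coordinates of the f-polynomial in the
  basis x^l (1 + x)^(d - l).\<close>

lemma face_sum_h_vec:
  assumes "finite K" "x \<noteq> -1"
  shows "face_sum K x = (\<Sum>l\<le>cdim K. of_int (h_vec K l) * (x ^ l * (1 + x) ^ (cdim K - l)))"
proof -
  define t where "t = x / (1 + x)"
  have nz: "1 + x \<noteq> 0" using assms by linarith
  have t: "1 - t = 1 / (1 + x)" "t \<noteq> 1" "t / (1 - t) = x"
    using nz by (auto simp: t_def field_simps)
  have "(\<Sum>l\<le>cdim K. of_int (h_vec K l) * (x ^ l * (1 + x) ^ (cdim K - l)))
      = (1 + x) ^ cdim K * (\<Sum>l\<le>cdim K. of_int (h_vec K l) * t ^ l)"
    unfolding t_def by (rule homogenize_sum[OF nz])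
  also have "\<dots> = (1 + x) ^ cdim K * ((1 - t) ^ cdim K * face_sum K x)"
    using poly_h_poly[OF assms(1) t(2)] by (simp add: poly_map_h_poly t(3))
  also have "\<dots> = face_sum K x"
    using nz by (simp add: t(1) power_one_over)
  finally show ?thesis by simp
qed

section \<open>Restricted Eulerian polynomials\<close>

text \<open>
  \<open>lam s p\<close> is the value at \<open>s\<close> of the rational function with power series \<open>\<Sum> p(n) s\<^sup>n\<close>, determined by
  linearity and the shift rule \<open>lam_shift\<close>; this avoids any convergence argument.
\<close>

function lam_mono :: "real \<Rightarrow> nat \<Rightarrow> real" where
  "lam_mono s k = ((if k = 0 then 1 else 0) + s * (\<Sum>i<k. of_nat (k choose i) * lam_mono s i)) / (1 - s)"
  by auto
termination by (relation "measure snd") auto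

declare lam_mono.simps [simp del]

definition lam :: "real \<Rightarrow> real poly \<Rightarrow> real" where
  "lam s p = (\<Sum>i\<le>degree p. coeff p i * lam_mono s i)"

lemma lam_eq: "degree p \<le> N \<Longrightarrow> lam s p = (\<Sum>i\<le>N. coeff p i * lam_mono s i)"
  unfolding lam_def by (rule sum.mono_neutral_left) (auto simp: coeff_eq_0)

lemma lam_add: "lam s (p + q) = lam s p + lam s q"
proof -
  define N where "N = max (degree p) (degree q)"
  have "degree (p + q) \<le> N" "degree p \<le> N" "degree q \<le> N"
    by (auto simp: N_def degree_add_le)
  then show ?thesis by (simp add: lam_eq algebra_simps sum.distrib)
qed

lemma lam_smult: "lam s (smult c p) = c * lam s p"
  using lam_eq[OF degree_smult_le[of c p], of s] lam_def[of s p]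
  by (simp add: sum_distrib_left algebra_simps)

lemma lam_0 [simp]: "lam s 0 = 0"
  by (simp add: lam_def)

lemma lam_diff: "lam s (p - q) = lam s p - lam s q"
  using lam_add[of s p "smult (-1) q"] lam_smult[of s "-1" q] by simp

lemma lam_sum: "lam s (\<Sum>i\<in>I. p i) = (\<Sum>i\<in>I. lam s (p i))"
  by (induction I rule: infinite_finite_induct) (simp_all add: lam_add)

text \<open>By linearity only monomials matter. For X^k, expanding (X + 1)^k and moving the term i =
  k to the left turns the rule into the defining equation of \<open>lam_mono\<close>.\<close>

lemma lam_shift:
  assumes "s \<noteq> 1"
  shows "lam s p = poly p 0 + s * lam s (p \<circ>\<^sub>p [:1, 1:])"
proof -
  have X: "lam s (monom 1 k) = lam_mono s k" for k
    by (simp add: lam_eq[OF degree_monom_le] coeff_monom if_distrib[of "\<lambda>a. a * _"] cong: if_cong)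
  have M: "lam s (monom 1 k) = poly (monom 1 k) 0 + s * lam s (monom 1 k \<circ>\<^sub>p [:1, 1:])" for k
  proof -
    have "monom 1 k \<circ>\<^sub>p [:1, 1:] = [:1, 1::real:] ^ k"
      by (rule poly_ext) (simp add: poly_pcompose poly_monom)
    also have "\<dots> = (\<Sum>i\<le>k. smult (of_nat (k choose i)) (monom 1 i))"
      by (rule poly_ext) (simp add: poly_sum poly_monom add.commute[of 1] binomial_ring)
    finally have 1: "lam s (monom 1 k \<circ>\<^sub>p [:1, 1:]) = (\<Sum>i\<le>k. of_nat (k choose i) * lam_mono s i)"
      by (simp only: lam_sum lam_smult X)
    have 2: "(\<Sum>i\<le>k. of_nat (k choose i) * lam_mono s i)
        = lam_mono s k + (\<Sum>i<k. of_nat (k choose i) * lam_mono s i)"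
      by (simp add: lessThan_Suc_atMost[symmetric])
    have "lam_mono s k = (if k = 0 then 1 else 0)
        + s * (lam_mono s k + (\<Sum>i<k. of_nat (k choose i) * lam_mono s i))"
      using assms lam_mono.simps[of s k] by (simp add: field_simps)
    then show ?thesis
      unfolding 1 2 X by (simp add: poly_monom power_0_left)
  qed
  have "p = (\<Sum>i\<le>degree p. smult (coeff p i) (monom 1 i))"
    using poly_as_sum_of_monoms[of p] by (simp add: smult_monom)
  moreover have "lam s (\<Sum>i\<le>n. smult (c i) (monom 1 i))
     = poly (\<Sum>i\<le>n. smult (c i) (monom 1 i)) 0 + s * lam s ((\<Sum>i\<le>n. smult (c i) (monom 1 i)) \<circ>\<^sub>p [:1, 1:])" for n c
    unfolding pcompose_sum pcompose_smult lam_sum lam_smult poly_sum poly_smult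
    by (subst M) (simp add: sum.distrib sum_distrib_left algebra_simps)
  ultimately show ?thesis by metis
qed

text \<open>For l \<le> d, the descent polynomial of the permutations of d + 1 letters that begin
  with the letter l + 1. Delete the first letter: it started a descent, worth a factor s, iff the
  next letter has rank j < l (counted from 0) among the remaining ones.\<close>

fun restricted_eulerian :: "real \<Rightarrow> nat \<Rightarrow> nat \<Rightarrow> real" where
  "restricted_eulerian s 0 l = 1"
| "restricted_eulerian s (Suc d) l
     = s * (\<Sum>j<l. restricted_eulerian s d j) + (\<Sum>j=l..d. restricted_eulerian s d j)"

text \<open>Since (X + 1) - X = 1, the polynomials X^l (X + 1)^(d + 1 - l) for neighbouring l differ
  by one of the same kind of degree d. So their transforms telescope, and the shift rule closes the
  cycle.\<close>

lemma lam_restricted_eulerian: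
  assumes "s \<noteq> 1" "l \<le> d"
  shows "(1 - s) ^ Suc d * lam s ([:0, 1:] ^ l * [:1, 1:] ^ (d - l)) = restricted_eulerian s d l"
  using assms(2)
proof (induction d arbitrary: l)
  case 0
  have "lam s 1 = 1 / (1 - s)"
    by (simp add: lam_def lam_mono.simps[of s 0])
  then show ?case using 0 assms(1) by simp
next
  case (Suc d)
  define q where "q d l = lam s ([:0, 1:] ^ l * [:1, 1:] ^ (d - l))" for d l
  have step: "q (Suc d) l = q (Suc d) (Suc l) + q d l" if "l \<le> d" for l
  proof -
    have "Suc d - l = Suc (d - l)" using that by simp
    then have "[:0, 1:] ^ l * [:1, 1::real:] ^ (Suc d - l)
        = [:0, 1:] ^ Suc l * [:1, 1:] ^ (Suc d - Suc l) + [:0, 1:] ^ l * [:1, 1:] ^ (d - l)"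
      by (intro poly_ext) (simp add: algebra_simps)
    then show ?thesis unfolding q_def by (simp only: lam_add)
  qed
  have tel: "q (Suc d) l = q (Suc d) (Suc d) + (\<Sum>j=l..d. q d j)" if "l \<le> Suc d" for l
    using that
  proof (induction "Suc d - l" arbitrary: l)
    case 0
    then show ?case by simp
  next
    case (Suc k)
    then have "l \<le> d" by simp
    have "q (Suc d) l = q (Suc d) (Suc l) + q d l" by (rule step) fact
    also have "q (Suc d) (Suc l) = q (Suc d) (Suc d) + (\<Sum>j=Suc l..d. q d j)"
      using Suc by (intro Suc.hyps) auto
    finally show ?case using \<open>l \<le> d\<close> by (simp add: sum.atLeast_Suc_atMost[of l d])
  qed
  \<comment> \<open>X^(d + 1) vanishes at 0, so the shift rule has no constant term and carries the
    index d + 1 to the index 0.\<close>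
  have top: "q (Suc d) (Suc d) = s * q (Suc d) 0"
  proof -
    have "[:0, 1:] ^ Suc d \<circ>\<^sub>p [:1, 1:] = [:1, 1::real:] ^ Suc d"
      by (rule poly_ext) (simp add: poly_pcompose algebra_simps)
    then show ?thesis
      using lam_shift[OF assms(1), of "[:0, 1:] ^ Suc d"] by (simp add: q_def)
  qed
  have split: "(\<Sum>j=0..d. q d j) = (\<Sum>j<l. q d j) + (\<Sum>j=l..d. q d j)"
    using Suc.prems by (subst sum.union_disjoint[symmetric]) (auto intro!: sum.cong)
  have total: "(1 - s) * q (Suc d) 0 = (\<Sum>j=0..d. q d j)"
    using tel[of 0] top by (simp add: algebra_simps)
  have "(1 - s) * q (Suc d) l = s * ((1 - s) * q (Suc d) 0) + (1 - s) * (\<Sum>j=l..d. q d j)"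
    unfolding tel[OF Suc.prems] top by (simp add: algebra_simps)
  also have "\<dots> = s * (\<Sum>j=0..d. q d j) + (1 - s) * (\<Sum>j=l..d. q d j)"
    unfolding total ..
  also have "\<dots> = s * (\<Sum>j<l. q d j) + (\<Sum>j=l..d. q d j)"
    unfolding split by (simp add: algebra_simps)
  finally have *: "(1 - s) * q (Suc d) l = s * (\<Sum>j<l. q d j) + (\<Sum>j=l..d. q d j)" .
  have IH: "(1 - s) ^ Suc d * q d j = restricted_eulerian s d j" if "j \<le> d" for j
    using Suc.IH[OF that] by (simp add: q_def)
  have "(1 - s) ^ Suc (Suc d) * q (Suc d) l = (1 - s) ^ Suc d * ((1 - s) * q (Suc d) l)"
    by simp
  also have "\<dots> = s * (\<Sum>j<l. (1 - s) ^ Suc d * q d j) + (\<Sum>j=l..d. (1 - s) ^ Suc d * q d j)"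
    unfolding * sum_distrib_left[symmetric] by (simp only: distrib_left mult.left_commute)
  also have "\<dots> = restricted_eulerian s (Suc d) l"
    using Suc.prems by (simp add: IH del: power_Suc)
  finally show ?case by (simp add: q_def)
qed

text \<open>
  With \<open>z = s / (1 + s\<^sup>2)\<close>, \<open>gam_r n l\<close> and \<open>gam_u n l\<close> are \<open>s A\<^sub>l + A\<^bsub>d-l\<^esub>\<close> and \<open>A\<^sub>l + A\<^bsub>d-l\<^esub>\<close> for \<open>d = n + 1\<close>,
  up to the normalising factors in \<open>eulerian_pairs_eq_gam\<close>.
\<close>

fun gam_r gam_u :: "nat \<Rightarrow> nat \<Rightarrow> real \<Rightarrow> real" where
  "gam_r 0 l z = 1"
| "gam_u 0 l z = 0"
| "gam_r (Suc n) l z = (1 + 2 * z) * (\<Sum>j<max 1 l. gam_r n j z)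
     + z * (\<Sum>j=max 1 l..Suc n div 2. gam_u n j z)"
| "gam_u (Suc n) l z = (1 + 2 * z) * (if 2 * l = n + 2 then 2 * (\<Sum>j<l. gam_r n j z)
     else (\<Sum>j=l..Suc n div 2. gam_u n j z) + 4 * (\<Sum>j<l. gam_r n j z))"

section \<open>Pairing the indices l and d - l\<close>

definition fold_sym :: "(nat \<Rightarrow> real) \<Rightarrow> nat \<Rightarrow> nat \<Rightarrow> real" where
  "fold_sym a d l = (if 2 * l = d then a l else a l + a (d - l))"

text \<open>The index l = d/2 is its own mirror image and is counted once. The induction peels off
  both ends of the range; 2 l = d + 1 is the empty range.\<close>

lemma sum_fold_sym:
  assumes "2 * l \<le> d + 1"
  shows "(\<Sum>j=l..d - l. a j) = (\<Sum>j=l..d div 2. fold_sym a d j)"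
  using assms
proof (induction "d + 1 - 2 * l" arbitrary: l rule: less_induct)
  case less
  consider "2 * l = d + 1" | "2 * l = d" | "2 * l < d"
    using less.prems by linarith
  then show ?case
  proof cases
    case 1
    then have "d - l < l" "d div 2 < l" by auto
    then show ?thesis by simp
  next
    case 2
    then have "d - l = l" "d div 2 = l" by auto
    then show ?thesis using 2 by (simp add: fold_sym_def)
  next
    case 3
    then have "l \<le> d - l" "Suc l \<le> d - l" "l \<le> d div 2" by auto
    have "(\<Sum>j=l..d - l. a j) = a l + (\<Sum>j=Suc l..d - l. a j)"
      using \<open>l \<le> d - l\<close> by (rule sum.atLeast_Suc_atMost)
    also have "(\<Sum>j=Suc l..d - l. a j) = (\<Sum>j=Suc l..d - Suc l. a j) + a (d - l)"
    proof -
      have "d - l = Suc (d - Suc l)" using 3 by simp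
      then show ?thesis using 3 by (simp add: sum.nat_ivl_Suc')
    qed
    also have "(\<Sum>j=Suc l..d - Suc l. a j) = (\<Sum>j=Suc l..d div 2. fold_sym a d j)"
      using 3 by (intro less.hyps) auto
    also have "a l + ((\<Sum>j=Suc l..d div 2. fold_sym a d j) + a (d - l))
        = (\<Sum>j=l..d div 2. fold_sym a d j)"
      using 3 \<open>l \<le> d div 2\<close> by (simp add: sum.atLeast_Suc_atMost[of l "d div 2"] fold_sym_def Suc_diff_Suc)
    finally show ?thesis .
  qed
qed

text \<open>Cuts {0..d} into a first block, a symmetric middle block and the mirror image of the
  first. The middle block can be folded, and the outer ones combine to pairs j, d - j.\<close>

lemma sum_split3:
  fixes a :: "nat \<Rightarrow> real"
  assumes "2 * l \<le> d + 1"
  shows "(\<Sum>j=l..d. a j) = (\<Sum>j=l..d - l. a j) + (\<Sum>j<l. a (d - j))"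
    and "(\<Sum>j<d + 1 - l. a j) = (\<Sum>j<l. a j) + (\<Sum>j=l..d - l. a j)"
    and "(\<Sum>j=d + 1 - l..d. a j) = (\<Sum>j<l. a (d - j))"
proof -
  show *: "(\<Sum>j=d + 1 - l..d. a j) = (\<Sum>j<l. a (d - j))"
    using assms by (intro sum.reindex_bij_witness[of _ "\<lambda>j. d - j" "\<lambda>j. d - j"]) auto
  have "{l..d} = {l..d - l} \<union> {d + 1 - l..d}" "{..<d + 1 - l} = {..<l} \<union> {l..d - l}"
    using assms by auto
  then show "(\<Sum>j=l..d. a j) = (\<Sum>j=l..d - l. a j) + (\<Sum>j<l. a (d - j))"
    and "(\<Sum>j<d + 1 - l. a j) = (\<Sum>j<l. a j) + (\<Sum>j=l..d - l. a j)"
    using assms unfolding *[symmetric] by (simp_all add: sum.union_disjoint disjoint_iff)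
qed

lemma restricted_eulerian_top: "restricted_eulerian s (Suc n) (Suc n) = s * restricted_eulerian s (Suc n) 0"
  by (simp add: atMost_atLeast0 lessThan_Suc_atMost)

context
  fixes s :: real
begin

private abbreviation "E \<equiv> restricted_eulerian s"

private abbreviation "R d l \<equiv> s * E d l + E d (d - l)"

private abbreviation "U d \<equiv> fold_sym (E d) d"

text \<open>In the recursions for l and d + 1 - l the outer blocks recombine to \<open>R d j\<close>
  with total factor 1 + s, and the middle block occurs twice with factor s. No subtraction
  arises.\<close>

private lemma R_Suc:
  assumes "2 * l \<le> d + 1"
  shows "R (Suc d) l = (1 + s) * (\<Sum>j<l. R d j) + 2 * s * (\<Sum>j=l..d div 2. U d j)"
proof -
  have "Suc d - l = d + 1 - l" by simp
  then show ?thesis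
    using sum_split3[OF assms, of "E d"] sum_fold_sym[OF assms, of "E d"]
    by (simp add: sum.distrib algebra_simps flip: sum_distrib_left)
qed

text \<open>At 2 l = d + 1 the index is its own mirror image: the middle block is empty and the
  outer blocks count once instead of twice.\<close>

private lemma U_Suc:
  assumes "2 * l \<le> d + 1"
  shows "U (Suc d) l = (if 2 * l = d + 1 then (\<Sum>j<l. R d j)
     else (1 + s) * (\<Sum>j=l..d div 2. U d j) + 2 * (\<Sum>j<l. R d j))"
proof -
  have "Suc d - l = d + 1 - l" by simp
  moreover have "{l..d div 2} = {}" if "2 * l = Suc d" using that by auto
  ultimately show ?thesis
    using sum_split3[OF assms, of "E d"] sum_fold_sym[OF assms, of "E d"]
    unfolding fold_sym_def
    by (auto simp add: sum.distrib algebra_simps simp flip: sum_distrib_left)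
qed

text \<open>Multiplied by powers of 1 + s, \<open>R_Suc\<close> and \<open>U_Suc\<close> become the
  recursion of \<open>gam_r\<close> and \<open>gam_u\<close>. For n = 0 the second claim is vacuous,
  so the start value 0 of \<open>gam_u\<close> is a mere default.\<close>

lemma eulerian_pairs_eq_gam:
  assumes z: "z = s / (1 + s\<^sup>2)"
  shows "2 * l \<le> n + 1 \<Longrightarrow> (1 + s) ^ n * R (Suc n) l = 2 * s * (1 + s\<^sup>2) ^ n * gam_r n l z"
    and "1 \<le> l \<Longrightarrow> 2 * l \<le> n + 1 \<Longrightarrow> (1 + s) ^ Suc n * U (Suc n) l = s * (1 + s\<^sup>2) ^ n * gam_u n l z"
proof (induction n arbitrary: l)
  case 0
  case 1
  then have "l = 0" by simp
  then show ?case by simp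
next
  case 0
  case 2
  then show ?case by simp
next
  case (Suc n)
  have v: "1 + s\<^sup>2 \<noteq> 0" using zero_le_power2[of s] by linarith
  \<comment> \<open>The choice of z turns both coefficients of the recursion into multiples of 1 +
    s^2.\<close>
  have w: "(1 + s)\<^sup>2 = (1 + s\<^sup>2) * (1 + 2 * z)" and zv: "s * x = (1 + s\<^sup>2) * (z * x)" for x
    using v unfolding z by (simp_all add: field_simps power2_eq_square)
  have SR: "(1 + s) ^ n * (\<Sum>j<l. R (Suc n) j) = 2 * s * (1 + s\<^sup>2) ^ n * (\<Sum>j<l. gam_r n j z)"
    if "2 * l \<le> n + 2" for l
    unfolding sum_distrib_left using that by (intro sum.cong refl Suc.IH(1)) auto
  have SU: "(1 + s) ^ Suc n * (\<Sum>j=l..Suc n div 2. U (Suc n) j)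
      = s * (1 + s\<^sup>2) ^ n * (\<Sum>j=l..Suc n div 2. gam_u n j z)"
    if "1 \<le> l" for l
    unfolding sum_distrib_left using that by (intro sum.cong refl Suc.IH(2)) auto
  {
    case 1
    have *: "(1 + s) ^ Suc n * R (Suc (Suc n)) l = 2 * s * (1 + s\<^sup>2) ^ Suc n * gam_r (Suc n) l z"
      if l: "1 \<le> l" "2 * l \<le> n + 2" for l
    proof -
      have "(1 + s) ^ Suc n * R (Suc (Suc n)) l
        = (1 + s)\<^sup>2 * ((1 + s) ^ n * (\<Sum>j<l. R (Suc n) j))
          + 2 * s * ((1 + s) ^ Suc n * (\<Sum>j=l..Suc n div 2. U (Suc n) j))"
        using l R_Suc[of l "Suc n"] by (simp add: algebra_simps power2_eq_square del: restricted_eulerian.simps)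
      also have "\<dots> = 2 * s * (1 + s\<^sup>2) ^ n * ((1 + s)\<^sup>2 * (\<Sum>j<l. gam_r n j z)
          + s * (\<Sum>j=l..Suc n div 2. gam_u n j z))"
        using SR[OF l(2)] SU[OF l(1)] by (simp add: algebra_simps)
      also have "(1 + s)\<^sup>2 * (\<Sum>j<l. gam_r n j z) + s * (\<Sum>j=l..Suc n div 2. gam_u n j z)
          = (1 + s\<^sup>2) * gam_r (Suc n) l z"
        using l(1) unfolding w zv[of "\<Sum>j=l..Suc n div 2. gam_u n j z"]
          by (simp add: max_absorb2 algebra_simps)
      finally show ?thesis by (simp add: algebra_simps)
    qed
    \<comment> \<open>This is the reason for \<open>max 1 l\<close> in \<open>gam_r\<close>. As the
      last Eulerian value is s times the one at 0, the term 2 s U_0 in the recursion at index 0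
      equals the term (1 + s) R_0 at index 1.\<close>
    have "R (Suc (Suc n)) 0 = R (Suc (Suc n)) 1"
    proof -
      show ?thesis
        using restricted_eulerian_top[of s n] R_Suc[of 0 "Suc n"] R_Suc[of 1 "Suc n"] sum.atLeast_Suc_atMost[of 0 "Suc n div 2" "U (Suc n)"]
        by (simp add: fold_sym_def algebra_simps del: restricted_eulerian.simps)
    qed
    then show ?case
      using 1 *[of l] *[of 1] by (cases "l = 0") (auto simp del: restricted_eulerian.simps)
  next
    case 2
    have e: "(if 2 * l = Suc n + 1 then (\<Sum>j<l. R (Suc n) j)
     else (1 + s) * (\<Sum>j=l..Suc n div 2. U (Suc n) j) + 2 * (\<Sum>j<l. R (Suc n) j)) * (1 + s) ^ Suc (Suc n)
       = s * (1 + s\<^sup>2) ^ n * ((1 + s)\<^sup>2 * (if 2 * l = n + 2 then 2 * (\<Sum>j<l. gam_r n j z)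
     else (\<Sum>j=l..Suc n div 2. gam_u n j z) + 4 * (\<Sum>j<l. gam_r n j z)))"
    proof (cases "2 * l = n + 2")
      case True
      then show ?thesis
        using SR[of l] by (simp add: algebra_simps power2_eq_square)
    next
      case False
      have "((1 + s) * (\<Sum>j=l..Suc n div 2. U (Suc n) j) + 2 * (\<Sum>j<l. R (Suc n) j)) * (1 + s) ^ Suc (Suc n)
         = (1 + s)\<^sup>2 * ((1 + s) ^ Suc n * (\<Sum>j=l..Suc n div 2. U (Suc n) j)
            + 2 * ((1 + s) ^ n * (\<Sum>j<l. R (Suc n) j)))"
        by (simp add: algebra_simps power2_eq_square del: restricted_eulerian.simps)
      also have "\<dots> = (1 + s)\<^sup>2 * (s * (1 + s\<^sup>2) ^ n * (\<Sum>j=l..Suc n div 2. gam_u n j z)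
            + 2 * (2 * s * (1 + s\<^sup>2) ^ n * (\<Sum>j<l. gam_r n j z)))"
        using 2 by (simp only: SR[of l] SU[of l])
      finally show ?thesis
        using False by (simp add: algebra_simps del: restricted_eulerian.simps)
    qed
    have p: "2 * l \<le> Suc n + 1" using 2 by simp
    show ?case
      by (subst mult.commute, subst U_Suc[OF p], subst e) (simp only: gam_u.simps w power_Suc ac_simps)
  }
qed

end

section \<open>Coloured complexes for the recursion\<close>

text \<open>The first component of a vertex is its colour.\<close>

type_synonym vertex = "nat \<times> nat \<times> nat"

text \<open>The number k of colours is a parameter and not tied to the dimension as in
  \<open>balanced\<close>. The existence statements below therefore also provide a face with k
  elements.\<close>

definition rainbow :: "nat \<Rightarrow> ('v \<Rightarrow> nat) \<Rightarrow> 'v set set \<Rightarrow> bool" where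
  "rainbow k \<kappa> K \<longleftrightarrow> simplicial_complex K \<and> (\<forall>F\<in>K. inj_on \<kappa> F \<and> \<kappa> ` F \<subseteq> {..<k})"

text \<open>The vertex (k, j, c) gets the new colour k and the link \<open>L j ! c\<close>; two new
  vertices never share a face. The index j marks the summand of the recursion that the vertex
  accounts for, so that a smaller J gives a subcomplex.\<close>

definition add_vertices ::
  "nat \<Rightarrow> vertex set set \<Rightarrow> nat set \<Rightarrow> (nat \<Rightarrow> vertex set set list) \<Rightarrow> vertex set set" where
  "add_vertices k K J L = K \<union> (\<Union>j\<in>J. \<Union>c<length (L j). insert (k, j, c) ` (L j ! c))"

definition subcomplexes :: "'v set set \<Rightarrow> 'v set set set" where
  "subcomplexes K = {L. simplicial_complex L \<and> L \<subseteq> K}"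

lemma rainbow_subcomplex: "rainbow k \<kappa> K \<Longrightarrow> L \<in> subcomplexes K \<Longrightarrow> rainbow k \<kappa> L"
  by (auto simp: rainbow_def subcomplexes_def)

lemma rainbow_finite: "rainbow k \<kappa> K \<Longrightarrow> F \<in> K \<Longrightarrow> finite F"
  by (simp add: rainbow_def simplicial_complex_def)

lemma rainbow_notin: "rainbow k fst K \<Longrightarrow> F \<in> K \<Longrightarrow> (k, i) \<notin> F"
  unfolding rainbow_def by (metis fst_conv image_eqI lessThan_iff less_irrefl subsetD)

lemma rainbow_add_vertices:
  assumes K: "rainbow k fst K" and J: "finite J" and L: "\<And>j. j \<in> J \<Longrightarrow> set (L j) \<subseteq> subcomplexes K"
  shows "rainbow (Suc k) fst (add_vertices k K J L)"
proof -
  let ?N = "add_vertices k K J L"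
  have sK: "simplicial_complex K" using K by (simp add: rainbow_def)
  have nth: "L j ! c \<in> subcomplexes K" if "j \<in> J" "c < length (L j)" for j c
    using L[OF that(1)] nth_mem[OF that(2)] by auto
  have cases: "F \<in> K \<or> (\<exists>j\<in>J. \<exists>c<length (L j). \<exists>G\<in>L j ! c. F = insert (k, j, c) G)" if "F \<in> ?N" for F
    using that by (auto simp: add_vertices_def)
  have fin: "finite ?N"
    unfolding add_vertices_def
    using sK J nth by (auto simp: simplicial_complex_def subcomplexes_def intro!: finite_UN_I)
  have sub: "H \<in> ?N" if F: "F \<in> ?N" and "H \<subseteq> F" for F H
    using cases[OF F]
  proof (elim disjE bexE exE conjE)
    assume "F \<in> K"
    then show ?thesis using sK \<open>H \<subseteq> F\<close> by (auto simp: simplicial_complex_def add_vertices_def)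
  next
    fix j c G assume jc: "j \<in> J" "c < length (L j)" and G: "G \<in> L j ! c" "F = insert (k, j, c) G"
    have "H - {(k, j, c)} \<subseteq> G" using G \<open>H \<subseteq> F\<close> by auto
    then have H: "H - {(k, j, c)} \<in> L j ! c"
      using nth[OF jc] G by (auto simp: subcomplexes_def simplicial_complex_def)
    show ?thesis
    proof (cases "(k, j, c) \<in> H")
      case True
      then have "H = insert (k, j, c) (H - {(k, j, c)})" by auto
      then have "H \<in> insert (k, j, c) ` (L j ! c)" using H by (rule image_eqI)
      then show ?thesis using jc by (auto simp: add_vertices_def)
    next
      case False
      then show ?thesis using H nth[OF jc] by (auto simp: subcomplexes_def add_vertices_def)
    qed
  qed
  have rb: "finite F \<and> inj_on fst F \<and> fst ` F \<subseteq> {..<Suc k}" if F: "F \<in> ?N" for F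
  proof -
    have *: "finite G \<and> inj_on fst G \<and> fst ` G \<subseteq> {..<k}" if "G \<in> K" for G
      using K that by (auto simp: rainbow_def simplicial_complex_def)
    from cases[OF F] show ?thesis
    proof (elim disjE bexE exE conjE)
      assume "F \<in> K"
      with * show ?thesis by fastforce
    next
      fix j c G assume jc: "j \<in> J" "c < length (L j)" and G: "G \<in> L j ! c" "F = insert (k, j, c) G"
      have "G \<in> K" using nth[OF jc] G by (auto simp: subcomplexes_def)
      from *[OF this] show ?thesis unfolding G(2) by (force simp: inj_on_insert)
    qed
  qed
  have "{} \<in> ?N" using sK by (auto simp: simplicial_complex_def add_vertices_def)
  then show ?thesis
    using fin sub rb unfolding rainbow_def simplicial_complex_def by blast
qed

text \<open>The new faces fall into classes by their unique new vertex, and each class is a copy of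
  the link with all sizes raised by one.\<close>

lemma face_sum_add_vertices:
  assumes K: "rainbow k fst K" and J: "finite J" and L: "\<And>j. j \<in> J \<Longrightarrow> set (L j) \<subseteq> subcomplexes K"
  shows "face_sum (add_vertices k K J L) z
     = face_sum K z + z * (\<Sum>j\<in>J. \<Sum>M\<leftarrow>L j. face_sum M z)"
proof -
  have nth: "L j ! c \<subseteq> K" "finite (L j ! c)" if "j \<in> J" "c < length (L j)" for j c
    using L[OF that(1)] nth_mem[OF that(2)] by (auto simp: subcomplexes_def simplicial_complex_def)
  have new: "finite F" "(k, i) \<notin> F" if "F \<in> K" for F i
    using rainbow_finite[OF K that] rainbow_notin[OF K that] by auto
  define I where "I = (SIGMA j:J. {..<length (L j)})"
  define C where "C = (\<lambda>(j, c). insert (k, j, c) ` (L j ! c))"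
  have "finite I" by (auto simp: I_def J)
  have finC: "\<forall>i\<in>I. finite (C i)" by (auto simp: I_def C_def nth)
  have eq: "add_vertices k K J L = K \<union> (\<Union>i\<in>I. C i)"
    by (auto simp: add_vertices_def I_def C_def)
  have disj: "K \<inter> (\<Union>i\<in>I. C i) = {}" using new by (auto simp: C_def)
  have disjC: "C i \<inter> C i' = {}" if ii: "i \<in> I" "i' \<in> I" "i \<noteq> i'" for i i'
  proof -
    have "(k, i) \<in> F" if "F \<in> C i" for F i using that by (auto simp: C_def)
    moreover have "(k, i') \<notin> F" if "F \<in> C i" for F
      using that ii nth(1) new(2) unfolding C_def I_def by fastforce
    ultimately show ?thesis by blast
  qed
  have "face_sum (add_vertices k K J L) z = face_sum K z + (\<Sum>F\<in>(\<Union>i\<in>I. C i). z ^ card F)"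
    unfolding eq face_sum_def
    using K \<open>finite I\<close> finC disj
    by (intro sum.union_disjoint) (auto simp: rainbow_def simplicial_complex_def)
  also have "(\<Sum>F\<in>(\<Union>i\<in>I. C i). z ^ card F) = (\<Sum>i\<in>I. \<Sum>F\<in>C i. z ^ card F)"
    using \<open>finite I\<close> finC disjC by (intro sum.UNION_disjoint) auto
  also have "\<dots> = (\<Sum>i\<in>I. z * face_sum (L (fst i) ! snd i) z)"
  proof (rule sum.cong)
    fix i assume "i \<in> I"
    then obtain j c where i: "i = (j, c)" "j \<in> J" "c < length (L j)" by (auto simp: I_def)
    have nK: "(k, j, c) \<notin> F" "finite F" if "F \<in> L j ! c" for F
      using that nth(1)[OF i(2,3)] new by auto
    have "inj_on (insert (k, j, c)) (L j ! c)"
      using nK by (auto simp: inj_on_def insert_ident)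
    then have "(\<Sum>F\<in>C i. z ^ card F) = (\<Sum>F\<in>L j ! c. z ^ card (insert (k, j, c) F))"
      by (simp add: C_def i(1) sum.reindex)
    also have "\<dots> = z * face_sum (L j ! c) z"
      unfolding face_sum_def sum_distrib_left using nK by (intro sum.cong) auto
    finally show "(\<Sum>F\<in>C i. z ^ card F) = z * face_sum (L (fst i) ! snd i) z"
      by (simp add: i(1))
  qed simp
  also have "\<dots> = z * (\<Sum>j\<in>J. \<Sum>c<length (L j). face_sum (L j ! c) z)"
    unfolding I_def using J by (subst sum.Sigma) (auto simp: sum_distrib_left split_def)
  also have "(\<Sum>j\<in>J. \<Sum>c<length (L j). face_sum (L j ! c) z) = (\<Sum>j\<in>J. \<Sum>M\<leftarrow>L j. face_sum M z)"
    by (rule sum.cong) (auto simp: sum_list_sum_nth atLeast0LessThan)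
  finally show ?thesis .
qed

lemma add_vertices_mono:
  assumes "K \<subseteq> K'" "J \<subseteq> J'" "\<And>j. j \<in> J \<Longrightarrow> length (L j) \<le> length (L' j)"
    "\<And>j c. j \<in> J \<Longrightarrow> c < length (L j) \<Longrightarrow> L j ! c \<subseteq> L' j ! c"
  shows "add_vertices k K J L \<subseteq> add_vertices k K' J' L'"
proof
  fix F assume "F \<in> add_vertices k K J L"
  then consider "F \<in> K" | j c G where "j \<in> J" "c < length (L j)" "G \<in> L j ! c" "F = insert (k, j, c) G"
    by (auto simp: add_vertices_def)
  then show "F \<in> add_vertices k K' J' L'"
  proof cases
    case 1
    then show ?thesis using assms(1) by (auto simp: add_vertices_def)
  next
    case 2
    then have "j \<in> J'" "c < length (L' j)" "G \<in> L' j ! c"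
      using assms(2) assms(3)[of j] assms(4)[of j c] by auto
    then show ?thesis using 2(4) by (auto simp: add_vertices_def)
  qed
qed

text \<open>A list, so that subcomplexes may be repeated. Taking its entries as links of new
  vertices realises the function z * p(z).\<close>

definition subcomplex_sum :: "'v set set \<Rightarrow> (real \<Rightarrow> real) \<Rightarrow> bool" where
  "subcomplex_sum K p \<longleftrightarrow>
     (\<exists>Ls. set Ls \<subseteq> subcomplexes K \<and> p = (\<lambda>z. \<Sum>L\<leftarrow>Ls. face_sum L z))"

lemma subcomplex_sum_face_sum: "L \<in> subcomplexes K \<Longrightarrow> subcomplex_sum K (face_sum L)"
  unfolding subcomplex_sum_def by (rule exI[of _ "[L]"]) auto

lemma subcomplex_sum_0: "subcomplex_sum K (\<lambda>z. 0)"
  unfolding subcomplex_sum_def by (rule exI[of _ "[]"]) auto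

lemma subcomplex_sum_add:
  assumes "subcomplex_sum K p" "subcomplex_sum K q"
  shows "subcomplex_sum K (\<lambda>z. p z + q z)"
proof -
  obtain Ls Ms where "set Ls \<subseteq> subcomplexes K" "p = (\<lambda>z. \<Sum>L\<leftarrow>Ls. face_sum L z)"
    "set Ms \<subseteq> subcomplexes K" "q = (\<lambda>z. \<Sum>L\<leftarrow>Ms. face_sum L z)"
    using assms unfolding subcomplex_sum_def by blast
  then show ?thesis
    unfolding subcomplex_sum_def by (intro exI[of _ "Ls @ Ms"]) auto
qed

lemma subcomplex_sum_sum:
  "(\<And>i. i \<in> I \<Longrightarrow> subcomplex_sum K (p i)) \<Longrightarrow> subcomplex_sum K (\<lambda>z. \<Sum>i\<in>I. p i z)"
  by (induction I rule: infinite_finite_induct) (simp_all add: subcomplex_sum_0 subcomplex_sum_add)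

lemma subcomplex_sum_of_nat: "subcomplex_sum K p \<Longrightarrow> subcomplex_sum K (\<lambda>z. of_nat m * p z)"
  using subcomplex_sum_sum[of "{..<m}" K "\<lambda>_. p"] by simp

text \<open>Over a subcomplex M of K, the two new vertices with link K form the suspension of M,
  whose face sum is 1 + 2 z times that of M.\<close>

lemma subcomplex_sum_cone:
  assumes K: "rainbow k fst K" and p: "subcomplex_sum K p" and "0 \<in> J" "L 0 = [K, K]"
  shows "subcomplex_sum (add_vertices k K J L) (\<lambda>z. (1 + 2 * z) * p z)"
proof -
  obtain Ls where Ls: "set Ls \<subseteq> subcomplexes K" and p: "p = (\<lambda>z. \<Sum>L\<leftarrow>Ls. face_sum L z)"
    using p unfolding subcomplex_sum_def by blast
  define D where "D M = add_vertices k M {0} (\<lambda>_. [M, M])" for M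
  have D: "D M \<in> subcomplexes (add_vertices k K J L)" "face_sum (D M) z = (1 + 2 * z) * face_sum M z"
    if "M \<in> set Ls" for M z
  proof -
    have M: "M \<in> subcomplexes K" using that Ls by auto
    have rb: "rainbow k fst M" by (rule rainbow_subcomplex[OF K M])
    have self: "set [M, M] \<subseteq> subcomplexes M"
      using M by (auto simp: subcomplexes_def)
    have "D M \<subseteq> add_vertices k K J L"
      unfolding D_def using M assms(3,4)
      by (intro add_vertices_mono) (auto simp: subcomplexes_def less_Suc_eq nth_Cons')
    then show "D M \<in> subcomplexes (add_vertices k K J L)"
      using rainbow_add_vertices[OF rb _ self, of "{0}"] by (simp add: subcomplexes_def D_def rainbow_def)
    show "face_sum (D M) z = (1 + 2 * z) * face_sum M z"
      unfolding D_def using face_sum_add_vertices[OF rb _ self, of "{0}"] by (simp add: algebra_simps)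
  qed
  show ?thesis
    unfolding subcomplex_sum_def
  proof (intro exI[of _ "map D Ls"] conjI ext)
    show "set (map D Ls) \<subseteq> subcomplexes (add_vertices k K J L)" using D(1) by auto
    show "(1 + 2 * z) * p z = (\<Sum>L\<leftarrow>map D Ls. face_sum L z)" for z
      using D(2) by (simp add: p sum_list_const_mult[symmetric] o_def cong: map_cong)
  qed
qed

lemma ex_face_add_vertices:
  assumes "rainbow k fst K" "F \<in> K" "0 \<in> J" "L 0 = [K, K]"
  shows "\<exists>F'\<in>add_vertices k K J L. card F' = Suc (card F)"
proof (rule bexI[of _ "insert (k, 0, 0) F"])
  have "finite F" "(k, 0, 0) \<notin> F"
    using rainbow_finite[OF assms(1,2)] rainbow_notin[OF assms(1,2)] by auto
  then show "card (insert (k, 0, 0) F) = Suc (card F)" by simp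
  show "insert (k, 0, 0) F \<in> add_vertices k K J L"
    unfolding add_vertices_def using assms(2-) by (intro UnI2 UN_I[of 0]) auto
qed

lemma ex_add_vertices:
  assumes K: "rainbow k fst K" and p: "\<And>j. 1 \<le> j \<Longrightarrow> j \<le> m \<Longrightarrow> subcomplex_sum K (p j)"
  obtains L where "L 0 = [K, K]" "\<And>j. j \<le> m \<Longrightarrow> set (L j) \<subseteq> subcomplexes K"
    "\<And>l z. 1 \<le> l \<Longrightarrow> face_sum (add_vertices k K (insert 0 {l..m}) L) z
        = (1 + 2 * z) * face_sum K z + z * (\<Sum>j=l..m. p j z)"
proof -
  have "\<forall>j. \<exists>Ls. j \<in> {1..m} \<longrightarrow> set Ls \<subseteq> subcomplexes K \<and> p j = (\<lambda>z. \<Sum>L\<leftarrow>Ls. face_sum L z)"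
    using p unfolding subcomplex_sum_def by (metis atLeastAtMost_iff)
  then obtain M where M: "\<And>j. j \<in> {1..m} \<Longrightarrow> set (M j) \<subseteq> subcomplexes K \<and> p j = (\<lambda>z. \<Sum>L\<leftarrow>M j. face_sum L z)"
    by metis
  \<comment> \<open>Index 0 is reserved for the two vertices over all of K, which produce the factor
    1 + 2 z; the indices j \<ge> 1 carry the links for \<open>p j\<close>.\<close>
  define L where "L = M(0 := [K, K])"
  have "K \<in> subcomplexes K" using K by (simp add: rainbow_def subcomplexes_def)
  then have L: "set (L j) \<subseteq> subcomplexes K" if "j \<le> m" for j
    using that M[of j] by (cases "j = 0") (auto simp: L_def)
  show ?thesis
  proof (rule that[of L])
    show "L 0 = [K, K]" by (simp add: L_def)
    show "set (L j) \<subseteq> subcomplexes K" if "j \<le> m" for j by (rule L[OF that])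
    show "face_sum (add_vertices k K (insert 0 {l..m}) L) z
        = (1 + 2 * z) * face_sum K z + z * (\<Sum>j=l..m. p j z)" if l: "1 \<le> l" for l z
    proof -
      have "(\<Sum>j=l..m. \<Sum>M\<leftarrow>L j. face_sum M z) = (\<Sum>j=l..m. p j z)"
        using l M by (intro sum.cong) (auto simp: L_def)
      moreover have "face_sum (add_vertices k K (insert 0 {l..m}) L) z
        = face_sum K z + z * (\<Sum>j\<in>insert 0 {l..m}. \<Sum>M\<leftarrow>L j. face_sum M z)"
        using l L by (intro face_sum_add_vertices[OF K]) auto
      ultimately show ?thesis
        using l by (simp add: L_def algebra_simps)
    qed
  qed
qed

text \<open>The induction needs every \<open>gam_r n l\<close> and \<open>gam_u n l\<close> as a sum
  over subcomplexes, since they feed the next stage; only \<open>gam_r n 0\<close> has to be the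
  face sum of the complex itself.\<close>

lemma ex_gam_complex:
  "\<exists>K :: vertex set set. rainbow n fst K \<and> (\<exists>F\<in>K. card F = n) \<and> gam_r n 0 = face_sum K \<and>
     (\<forall>l. subcomplex_sum K (gam_r n l)) \<and> (\<forall>l. subcomplex_sum K (gam_u n l))"
proof (induction n)
  case 0
  let ?K = "{{}} :: vertex set set"
  have r: "gam_r 0 l = face_sum ?K" for l
    by (simp add: face_sum_def fun_eq_iff)
  have u: "gam_u 0 l = (\<lambda>z. 0)" for l
    by (simp add: fun_eq_iff)
  have "?K \<in> subcomplexes ?K" and rb: "rainbow 0 fst ?K"
    by (auto simp: subcomplexes_def rainbow_def simplicial_complex_def)
  then have "subcomplex_sum ?K (gam_r 0 l)" "subcomplex_sum ?K (gam_u 0 l)" for l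
    unfolding r u by (simp_all only: subcomplex_sum_face_sum subcomplex_sum_0)
  moreover have "\<exists>F\<in>?K. card F = 0" by simp
  ultimately show ?case using r rb by blast
next
  case (Suc n)
  then obtain K :: "vertex set set" and F where K: "rainbow n fst K" and F: "F \<in> K" "card F = n" and r0: "gam_r n 0 = face_sum K"
    and r: "\<And>l. subcomplex_sum K (gam_r n l)" and u: "\<And>l. subcomplex_sum K (gam_u n l)"
    by blast
  define m where "m = Suc n div 2"
  obtain L where L: "L 0 = [K, K]" "\<And>j. j \<le> m \<Longrightarrow> set (L j) \<subseteq> subcomplexes K"
    and fs: "\<And>l z. 1 \<le> l \<Longrightarrow> face_sum (add_vertices n K (insert 0 {l..m}) L) z
        = (1 + 2 * z) * face_sum K z + z * (\<Sum>j=l..m. gam_u n j z)"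
    by (rule ex_add_vertices[OF K, of m "gam_u n"]) (rule u, rule that)
  \<comment> \<open>\<open>N l\<close> omits the new vertices with index 1, ..., l - 1, so for l
    \<ge> 1 it lies in \<open>N 1\<close>, which is the next complex.\<close>
  define N where "N l = add_vertices n K (insert 0 {l..m}) L" for l
  have rbN: "rainbow (Suc n) fst (N l)" for l
    unfolding N_def using L(2) by (intro rainbow_add_vertices[OF K]) auto
  have subN: "N l \<in> subcomplexes (N 1)" if "1 \<le> l" for l
  proof -
    have "N l \<subseteq> N 1" unfolding N_def using that by (intro add_vertices_mono) auto
    then show ?thesis using rbN by (simp add: subcomplexes_def rainbow_def)
  qed
  have cone: "subcomplex_sum (N 1) (\<lambda>z. (1 + 2 * z) * p z)" if "subcomplex_sum K p" for p
    unfolding N_def using L(1) that by (intro subcomplex_sum_cone[OF K]) auto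
  \<comment> \<open>The summand j = 0 is the face sum of K and makes up \<open>N (max 1 l)\<close>
    together with the \<open>gam_u\<close> terms; the other \<open>gam_r\<close> terms get
    suspended.\<close>
  have r_eq: "gam_r (Suc n) l = (\<lambda>z. face_sum (N (max 1 l)) z + (1 + 2 * z) * (\<Sum>j=1..<l. gam_r n j z))" for l
  proof
    fix z
    have "(\<Sum>j<max 1 l. gam_r n j z) = gam_r n 0 z + (\<Sum>j=1..<l. gam_r n j z)"
    proof -
      have "{..<max 1 l} = insert 0 {1..<l}" by auto
      then show ?thesis by simp
    qed
    then show "gam_r (Suc n) l z = face_sum (N (max 1 l)) z + (1 + 2 * z) * (\<Sum>j=1..<l. gam_r n j z)"
      unfolding gam_r.simps m_def[symmetric] N_def fs[OF max.cobounded1] r0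
      by (simp only: distrib_left add.assoc add.commute)
  qed
  have g0: "gam_r (Suc n) 0 = face_sum (N 1)" by (subst r_eq) simp
  have gr: "subcomplex_sum (N 1) (gam_r (Suc n) l)" for l
  proof -
    have "subcomplex_sum K (\<lambda>z. \<Sum>j=1..<l. gam_r n j z)"
      by (rule subcomplex_sum_sum) (rule r)
    from subcomplex_sum_add[OF subcomplex_sum_face_sum[OF subN] cone[OF this], of "max 1 l"]
    show ?thesis unfolding r_eq by simp
  qed
  have gu: "subcomplex_sum (N 1) (gam_u (Suc n) l)" for l
  proof -
    have sr: "subcomplex_sum K (\<lambda>z. \<Sum>j<l. gam_r n j z)"
      by (rule subcomplex_sum_sum) (rule r)
    have su: "subcomplex_sum K (\<lambda>z. \<Sum>j=l..Suc n div 2. gam_u n j z)"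
      by (rule subcomplex_sum_sum) (rule u)
    show ?thesis
    proof (cases "2 * l = n + 2")
      case True
      then have "gam_u (Suc n) l = (\<lambda>z. (1 + 2 * z) * (of_nat 2 * (\<Sum>j<l. gam_r n j z)))"
        by (simp add: fun_eq_iff)
      then show ?thesis
        using cone[OF subcomplex_sum_of_nat[OF sr, of 2]] by (simp only:)
    next
      case False
      then have "gam_u (Suc n) l = (\<lambda>z. (1 + 2 * z) *
          ((\<Sum>j=l..Suc n div 2. gam_u n j z) + of_nat 4 * (\<Sum>j<l. gam_r n j z)))"
        by (simp add: fun_eq_iff)
      then show ?thesis
        using cone[OF subcomplex_sum_add[OF su subcomplex_sum_of_nat[OF sr, of 4]]] by (simp only:)
    qed
  qed
  have top: "\<exists>F'\<in>N 1. card F' = Suc n"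
    using ex_face_add_vertices[OF K F(1), of "insert 0 {1..m}" L] L(1) F(2) by (simp add: N_def)
  show ?case
    by (intro exI[of _ "N 1"] conjI allI rbN top g0 gr gu)
qed

section \<open>The even part of a coloured complex\<close>

definition ends :: "('v \<times> 'v) set \<Rightarrow> 'v set" where
  "ends Q = fst ` Q \<union> snd ` Q"

text \<open>The pairs span disjoint closed intervals of colours, so each pair is consecutive by
  colour among all ends.\<close>

definition separated :: "('v \<Rightarrow> nat) \<Rightarrow> ('v \<times> 'v) set \<Rightarrow> bool" where
  "separated \<kappa> Q \<longleftrightarrow> (\<forall>p\<in>Q. \<kappa> (fst p) < \<kappa> (snd p)) \<and>
     (\<forall>p\<in>Q. \<forall>q\<in>Q. p \<noteq> q \<longrightarrow> \<kappa> (snd p) < \<kappa> (fst q) \<or> \<kappa> (snd q) < \<kappa> (fst p))"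

definition pair_complex :: "('v \<Rightarrow> nat) \<Rightarrow> 'v set set \<Rightarrow> ('v \<times> 'v) set set" where
  "pair_complex \<kappa> K = {Q. separated \<kappa> Q \<and> ends Q \<in> K}"

lemma ends_insert: "ends (insert (a, b) Q) = {a, b} \<union> ends Q"
  by (auto simp: ends_def)

lemma ends_mono: "P \<subseteq> Q \<Longrightarrow> ends P \<subseteq> ends Q"
  by (auto simp: ends_def)

lemma subset_ends: "Q \<subseteq> ends Q \<times> ends Q"
  by (force simp: ends_def)

lemma separated_subset: "separated \<kappa> Q \<Longrightarrow> P \<subseteq> Q \<Longrightarrow> separated \<kappa> P"
  unfolding separated_def by blast

lemma separated_disjoint:
  assumes sep: "separated \<kappa> (insert (a, b) Q)" and ab: "(a, b) \<notin> Q"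
  shows "a \<notin> ends Q" "b \<notin> ends Q" "a \<noteq> b"
proof -
  have "\<kappa> a < \<kappa> b" using sep by (auto simp: separated_def)
  moreover have "\<kappa> b < \<kappa> (fst q) \<or> \<kappa> (snd q) < \<kappa> a" "\<kappa> (fst q) < \<kappa> (snd q)" if "q \<in> Q" for q
    using sep that ab unfolding separated_def by (metis fst_conv snd_conv insertCI)+
  ultimately show "a \<notin> ends Q" "b \<notin> ends Q" "a \<noteq> b"
    unfolding ends_def by fastforce+
qed

lemma card_ends:
  assumes "finite Q" "separated \<kappa> Q"
  shows "card (ends Q) = 2 * card Q"
  using assms
proof (induction Q rule: finite_induct)
  case empty
  then show ?case by (simp add: ends_def)
next
  case (insert p Q)
  obtain a b where p: "p = (a, b)" by (cases p)
  have "a \<notin> ends Q" "b \<notin> ends Q" "a \<noteq> b"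
    using separated_disjoint[of \<kappa> a b Q] insert.prems insert.hyps p by auto
  moreover have "finite (ends Q)" using insert.hyps by (simp add: ends_def)
  ultimately have "card (ends (insert p Q)) = 2 + card (ends Q)"
    by (simp add: p ends_insert)
  also have "card (ends Q) = 2 * card Q"
    using insert.prems by (intro insert.IH separated_subset[OF insert.prems]) auto
  finally show ?case using insert.hyps by simp
qed

text \<open>The vertices a and b of the two lowest colours are forced to form a pair; the rest is
  the induction hypothesis.\<close>

lemma ex1_pairing:
  assumes "finite F" "inj_on \<kappa> F" "even (card F)"
  shows "\<exists>!Q. separated \<kappa> Q \<and> ends Q = F"
  using assms
proof (induction F rule: finite_psubset_induct)
  case (psubset F)
  show ?case
  proof (cases "F = {}")
    case True
    show ?thesis
      unfolding True by (rule ex1I[of _ "{}"]) (simp_all add: ends_def separated_def)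
  next
    case False
    have ex_min: "\<exists>a\<in>S. \<forall>x\<in>S. \<kappa> a \<le> \<kappa> x" if "S \<noteq> {}" for S
      using that by (meson ex_has_least_nat[of "\<lambda>x. x \<in> S" _ \<kappa>] ex_in_conv)
    obtain a where a: "a \<in> F" "\<And>x. x \<in> F \<Longrightarrow> \<kappa> a \<le> \<kappa> x" using ex_min[OF False] by blast
    have "F \<noteq> {a}" using psubset.prems by auto
    then have "F - {a} \<noteq> {}" using a by auto
    from ex_min[OF this] obtain b where b: "b \<in> F" "b \<noteq> a"
      "\<And>x. x \<in> F \<Longrightarrow> x \<noteq> a \<Longrightarrow> \<kappa> b \<le> \<kappa> x" by blast
    have inj: "x = y" if "x \<in> F" "y \<in> F" "\<kappa> x = \<kappa> y" for x y
      using psubset.prems(1) that by (auto dest: inj_onD)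
    have ab: "\<kappa> a < \<kappa> b" using a b inj by (metis le_neq_implies_less)
    define G where "G = F - {a, b}"
    have G: "\<kappa> b < \<kappa> x" if "x \<in> G" for x
      using that b inj unfolding G_def by (metis DiffE insertCI le_neq_implies_less)
    have cG: "card G = card F - 2" using a b psubset.hyps by (simp add: G_def card_Diff_subset)
    have "\<exists>!Q. separated \<kappa> Q \<and> ends Q = G"
      using a psubset.prems cG by (intro psubset.IH) (auto simp: G_def intro: inj_on_subset)
    then obtain P where P: "separated \<kappa> P" "ends P = G"
      and uniq: "\<And>Q. separated \<kappa> Q \<Longrightarrow> ends Q = G \<Longrightarrow> Q = P"
      by blast
    show ?thesis
    proof (rule ex1I[of _ "insert (a, b) P"])
      have "\<kappa> b < \<kappa> (fst q)" if "q \<in> P" for q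
        using G P(2) that by (auto simp: ends_def)
      then have "separated \<kappa> (insert (a, b) P)"
        using P(1) ab unfolding separated_def by simp
      moreover have "ends (insert (a, b) P) = F"
        using a b by (auto simp: ends_insert P G_def)
      ultimately show "separated \<kappa> (insert (a, b) P) \<and> ends (insert (a, b) P) = F" ..
    next
      fix Q assume Q: "separated \<kappa> Q \<and> ends Q = F"
      have endsQ: "fst q \<in> F" "snd q \<in> F" "\<kappa> (fst q) < \<kappa> (snd q)" if "q \<in> Q" for q
        using Q that by (auto simp: ends_def separated_def)
      have "a \<in> ends Q" using Q a by simp
      then obtain q where q: "q \<in> Q" "a = fst q \<or> a = snd q" by (auto simp: ends_def)
      have qa: "a = fst q" using q endsQ[OF q(1)] a(2)[of "fst q"] by auto
      \<comment> \<open>Otherwise the colour of b lies inside the interval spanned by the pair of a,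
        and the pair containing b would overlap that interval.\<close>
      have qb: "snd q = b"
      proof (rule ccontr)
        assume ne: "snd q \<noteq> b"
        have "b \<in> ends Q" using Q b by simp
        then obtain p where p: "p \<in> Q" "b = fst p \<or> b = snd p" by (auto simp: ends_def)
        have "p \<noteq> q" using p(2) qa ne b by auto
        then have "\<kappa> (snd q) < \<kappa> (fst p) \<or> \<kappa> (snd p) < \<kappa> a"
          using Q p(1) q(1) qa unfolding separated_def by metis
        moreover have "\<kappa> a \<le> \<kappa> (snd p)" using a endsQ[OF p(1)] by simp
        moreover have "\<kappa> b \<le> \<kappa> (snd q)" using b(3)[of "snd q"] endsQ[OF q(1)] qa by (cases "snd q = a") auto
        moreover have "\<kappa> (fst p) \<le> \<kappa> b" using p endsQ[OF p(1)] by auto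
        ultimately show False by simp
      qed
      define Q' where "Q' = Q - {(a, b)}"
      have abQ: "(a, b) \<in> Q" using q(1) qa qb by (cases q) auto
      then have Q': "Q = insert (a, b) Q'" by (auto simp: Q'_def)
      have sep: "separated \<kappa> Q'" using Q by (auto simp: Q'_def intro: separated_subset)
      have "(a, b) \<notin> Q'" by (simp add: Q'_def)
      moreover have "separated \<kappa> (insert (a, b) Q')" using Q Q' by metis
      ultimately have "a \<notin> ends Q'" "b \<notin> ends Q'" by (simp_all add: separated_disjoint)
      moreover have "F = {a, b} \<union> ends Q'" using Q Q' ends_insert by metis
      ultimately have "ends Q' = G" unfolding G_def by blast
      then show "Q = insert (a, b) P" using uniq[OF sep] Q' by simp
    qed
  qed
qed

lemma pair_complex_finite:
  assumes "rainbow k \<kappa> K" "Q \<in> pair_complex \<kappa> K"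
  shows "finite Q"
proof -
  have "finite (ends Q)"
    using assms by (auto simp: pair_complex_def rainbow_def simplicial_complex_def)
  then have "finite (ends Q \<times> ends Q)" by simp
  then show ?thesis by (rule finite_subset[OF subset_ends])
qed

lemma bij_betw_ends:
  assumes "rainbow k \<kappa> K"
  shows "bij_betw ends (pair_complex \<kappa> K) {F \<in> K. even (card F)}"
proof -
  have K: "finite F" "inj_on \<kappa> F" if "F \<in> K" for F
    using assms that by (auto simp: rainbow_def simplicial_complex_def)
  have ev: "even (card (ends Q))" if "Q \<in> pair_complex \<kappa> K" for Q
  proof -
    have "separated \<kappa> Q" "ends Q \<in> K" using that by (auto simp: pair_complex_def)
    moreover have "finite Q" by (rule pair_complex_finite[OF assms that])
    ultimately show ?thesis by (simp add: card_ends)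
  qed
  show ?thesis
    unfolding bij_betw_def
  proof
    show "inj_on ends (pair_complex \<kappa> K)"
    proof (rule inj_onI)
      fix P Q assume PQ: "P \<in> pair_complex \<kappa> K" "Q \<in> pair_complex \<kappa> K" "ends P = ends Q"
      then have "ends P \<in> K" by (simp add: pair_complex_def)
      from ex1_pairing[OF K[OF this] ev[OF PQ(1)]] PQ show "P = Q"
        unfolding pair_complex_def by auto
    qed
    have "F \<in> ends ` pair_complex \<kappa> K" if "F \<in> K" "even (card F)" for F
      using ex1_pairing[OF K[OF that(1)] that(2)] that(1) unfolding pair_complex_def by blast
    moreover have "ends Q \<in> K" if "Q \<in> pair_complex \<kappa> K" for Q
      using that by (simp add: pair_complex_def)
    ultimately show "ends ` pair_complex \<kappa> K = {F \<in> K. even (card F)}"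
      using ev by blast
  qed
qed

text \<open>Pairing halves the sizes of the even faces, and averaging over z and -z removes the odd
  ones.\<close>

lemma face_sum_pair_complex:
  assumes "rainbow k \<kappa> K"
  shows "face_sum (pair_complex \<kappa> K) (z\<^sup>2) = (face_sum K z + face_sum K (- z)) / 2"
proof -
  have fin: "finite K" using assms by (simp add: rainbow_def simplicial_complex_def)
  have "face_sum (pair_complex \<kappa> K) (z\<^sup>2) = (\<Sum>Q\<in>pair_complex \<kappa> K. z ^ card (ends Q))"
    unfolding face_sum_def
  proof (rule sum.cong)
    fix Q assume Q: "Q \<in> pair_complex \<kappa> K"
    have "separated \<kappa> Q" using Q by (simp add: pair_complex_def)
    from card_ends[OF pair_complex_finite[OF assms Q] this]
    show "(z\<^sup>2) ^ card Q = z ^ card (ends Q)" by (simp add: power_mult)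
  qed simp
  also have "\<dots> = (\<Sum>F\<in>{F \<in> K. even (card F)}. z ^ card F)"
    by (rule sum.reindex_bij_betw[OF bij_betw_ends[OF assms]])
  also have "\<dots> = (\<Sum>F\<in>K. if even (card F) then z ^ card F else 0)"
    using fin by (simp add: sum.inter_filter)
  also have "\<dots> = (\<Sum>F\<in>K. (z ^ card F + (- z) ^ card F) / 2)"
    by (rule sum.cong) auto
  finally show ?thesis
    by (simp add: face_sum_def sum.distrib sum_divide_distrib[symmetric])
qed

text \<open>The second end of the lower of two pairs has a colour strictly between the two first
  ends. So first ends differ by at least 2 and halving keeps them apart; as second ends stay below
  k, first ends are at most k - 2.\<close>

lemma rainbow_pair_complex:
  assumes K: "rainbow k \<kappa> K"
  shows "rainbow (k div 2) (\<lambda>p. \<kappa> (fst p) div 2) (pair_complex \<kappa> K)"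
proof -
  have sK: "simplicial_complex K" using K by (simp add: rainbow_def)
  have "finite (pair_complex \<kappa> K)"
    using bij_betw_finite[OF bij_betw_ends[OF K]] sK by (simp add: simplicial_complex_def)
  moreover have "{} \<in> pair_complex \<kappa> K"
    using sK by (simp add: pair_complex_def separated_def ends_def simplicial_complex_def)
  moreover have "P \<in> pair_complex \<kappa> K" if "Q \<in> pair_complex \<kappa> K" "P \<subseteq> Q" for P Q
    using that sK ends_mono[OF that(2)] separated_subset[of \<kappa> Q P]
    by (auto simp: pair_complex_def simplicial_complex_def)
  ultimately have "simplicial_complex (pair_complex \<kappa> K)"
    using pair_complex_finite[OF K] by (auto simp: simplicial_complex_def)
  moreover have "inj_on (\<lambda>p. \<kappa> (fst p) div 2) Q \<and> (\<lambda>p. \<kappa> (fst p) div 2) ` Q \<subseteq> {..<k div 2}"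
    if Q: "Q \<in> pair_complex \<kappa> K" for Q
  proof
    have sep: "separated \<kappa> Q" and "ends Q \<in> K" using Q by (auto simp: pair_complex_def)
    then have "\<kappa> ` ends Q \<subseteq> {..<k}" using K by (simp add: rainbow_def)
    then have bound: "\<kappa> (snd p) < k" if "p \<in> Q" for p
      using that by (auto simp: ends_def)
    show "inj_on (\<lambda>p. \<kappa> (fst p) div 2) Q"
    proof (rule inj_onI, rule ccontr)
      fix p q assume pq: "p \<in> Q" "q \<in> Q" "\<kappa> (fst p) div 2 = \<kappa> (fst q) div 2" "p \<noteq> q"
      then have "\<kappa> (snd p) < \<kappa> (fst q) \<or> \<kappa> (snd q) < \<kappa> (fst p)"
        "\<kappa> (fst p) < \<kappa> (snd p)" "\<kappa> (fst q) < \<kappa> (snd q)"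
        using sep unfolding separated_def by blast+
      then show False using pq(3) by linarith
    qed
    have "\<kappa> (fst p) div 2 < k div 2" if "p \<in> Q" for p
    proof -
      have "\<kappa> (fst p) < \<kappa> (snd p)" using sep that by (simp add: separated_def)
      then show ?thesis using bound[OF that] by linarith
    qed
    then show "(\<lambda>p. \<kappa> (fst p) div 2) ` Q \<subseteq> {..<k div 2}" by auto
  qed
  ultimately show ?thesis by (simp add: rainbow_def)
qed

lemma ex_face_pair_complex:
  assumes K: "rainbow k \<kappa> K" and F: "F \<in> K" "card F = k"
  shows "\<exists>Q\<in>pair_complex \<kappa> K. card Q = k div 2"
proof -
  \<comment> \<open>For odd k one vertex is dropped.\<close>
  obtain G where G: "G \<subseteq> F" "card G = 2 * (k div 2)"
    using obtain_subset_with_card_n[of "2 * (k div 2)" F] F by auto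
  then have "G \<in> {G \<in> K. even (card G)}"
    using K F by (auto simp: rainbow_def simplicial_complex_def)
  then obtain Q where Q: "Q \<in> pair_complex \<kappa> K" "ends Q = G"
    using bij_betw_imp_surj_on[OF bij_betw_ends[OF K]] by (metis imageE)
  have "separated \<kappa> Q" using Q by (simp add: pair_complex_def)
  from card_ends[OF pair_complex_finite[OF K Q(1)] this] have "card Q = k div 2"
    using Q G by simp
  then show ?thesis using Q by blast
qed

text \<open>Relabels the vertices by \<open>to_nat\<close>. The face with k elements makes
  \<open>cdim\<close> equal to the number of colours, as \<open>balanced\<close> demands.\<close>

lemma ex_nat_complex:
  fixes K :: "'v::countable set set"
  assumes K: "rainbow k \<kappa> K" and F: "F \<in> K" "card F = k"
  shows "\<exists>\<Gamma> :: nat set set. simplicial_complex \<Gamma> \<and> balanced \<Gamma> \<and> cdim \<Gamma> = k \<and> face_sum \<Gamma> = face_sum K"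
proof -
  let ?g = "to_nat :: 'v \<Rightarrow> nat"
  define \<Gamma> where "\<Gamma> = (`) ?g ` K"
  have inj: "inj ?g" by simp
  have card: "card (?g ` G) = card G" for G
    by (rule card_image) (rule inj_on_subset[OF inj], simp)
  have sK: "simplicial_complex K" using K by (simp add: rainbow_def)
  have "simplicial_complex \<Gamma>"
    using sK unfolding simplicial_complex_def \<Gamma>_def by (auto simp: subset_image_iff)
  moreover have dim: "cdim \<Gamma> = k"
  proof -
    have "card ` \<Gamma> = card ` K" by (auto simp: \<Gamma>_def image_image card)
    moreover have "card G \<le> k" if "G \<in> K" for G
      using K that card_inj_on_le[of \<kappa> G "{..<k}"] by (auto simp: rainbow_def)
    moreover have "finite (card ` K)" using sK by (simp add: simplicial_complex_def)
    ultimately show ?thesis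
      unfolding cdim_def using F by (auto intro!: Max_eqI)
  qed
  moreover have "balanced \<Gamma>"
    unfolding balanced_def dim
  proof (intro exI[of _ "\<kappa> \<circ> inv ?g"] conjI ballI)
    show "(\<kappa> \<circ> inv ?g) v < k" if "G \<in> \<Gamma>" "v \<in> G" for G v
      using that K by (auto simp: \<Gamma>_def rainbow_def image_subset_iff)
    show "inj_on (\<kappa> \<circ> inv ?g) G" if "G \<in> \<Gamma>" for G
      using that K by (auto simp: \<Gamma>_def rainbow_def inj_on_def)
  qed
  moreover have "face_sum \<Gamma> = face_sum K"
  proof
    have "inj_on ((`) ?g) K" using inj by (simp add: inj_on_def inj_image_eq_iff)
    then show "face_sum \<Gamma> z = face_sum K z" for z
      unfolding face_sum_def \<Gamma>_def by (simp add: sum.reindex card)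
  qed
  ultimately show ?thesis by blast
qed

section \<open>Chains of intervals\<close>

text \<open>The counterpart of \<open>lam\<close> for \<open>\<Sum> p(2m - 1) s\<^bsup>2m\<^esup>\<close> over \<open>m \<ge> 1\<close>.\<close>

definition omega :: "real \<Rightarrow> real poly \<Rightarrow> real" where
  "omega s p = s / 2 * (lam s p - lam (- s) p)"

lemma omega_sum: "omega s (\<Sum>i\<in>I. p i) = (\<Sum>i\<in>I. omega s (p i))"
  unfolding omega_def lam_sum sum_subtractf[symmetric] sum_distrib_left ..

lemma omega_diff: "omega s (p - q) = omega s p - omega s q"
  by (simp add: omega_def lam_diff algebra_simps)

text \<open>The shift rule is applied twice, at s and at -s. On subtracting, the contributions of
  \<open>poly p 0\<close> cancel and those of \<open>poly p 1\<close> add up.\<close>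

lemma omega_shift2:
  assumes "s \<noteq> 1" "s \<noteq> -1"
  shows "omega s p = s\<^sup>2 * poly p 1 + s\<^sup>2 * omega s (p \<circ>\<^sub>p [:2, 1:])"
proof -
  have "(p \<circ>\<^sub>p [:1, 1:]) \<circ>\<^sub>p [:1, 1:] = p \<circ>\<^sub>p [:2, 1:]"
    by (rule poly_ext) (simp add: poly_pcompose add.assoc[symmetric])
  then have "lam r p = poly p 0 + r * (poly p 1 + r * lam r (p \<circ>\<^sub>p [:2, 1:]))" if "r \<noteq> 1" for r
    using lam_shift[OF that, of p] lam_shift[OF that, of "p \<circ>\<^sub>p [:1, 1:]"] by (simp add: poly_pcompose)
  note expand = this
  show ?thesis
    unfolding omega_def using assms
    by (subst expand[of s], simp, subst expand[of "- s"], simp) (simp add: field_simps power2_eq_square)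
qed

section \<open>Generating functions of intervals of sets\<close>

lemma sum_Pow_power_card:
  fixes x :: "'b::comm_ring_1"
  assumes "finite S"
  shows "(\<Sum>T\<in>Pow S. x ^ card T) = (1 + x) ^ card S"
  using assms
proof (induction S rule: finite_induct)
  case (insert a S)
  have fin: "finite T" "a \<notin> T" if "T \<in> Pow S" for T
    using that insert.hyps finite_subset by auto
  have "(\<Sum>T\<in>Pow (insert a S). x ^ card T) = (\<Sum>T\<in>Pow S. x ^ card T) + (\<Sum>T\<in>insert a ` Pow S. x ^ card T)"
    unfolding Pow_insert using insert.hyps by (intro sum.union_disjoint) auto
  also have "(\<Sum>T\<in>insert a ` Pow S. x ^ card T) = (\<Sum>T\<in>Pow S. x ^ card (insert a T))"
    using fin by (subst sum.reindex) (auto simp: inj_on_def insert_ident)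
  also have "\<dots> = x * (\<Sum>T\<in>Pow S. x ^ card T)"
    unfolding sum_distrib_left using fin by (intro sum.cong) auto
  finally show ?case using insert by (simp add: algebra_simps)
qed simp

text \<open>Both C - A and B - C run through the subsets of B - A. The ring is general so that x can
  be the polynomial X.\<close>

lemma sum_interval_power_card:
  fixes x :: "'b::comm_ring_1"
  assumes "finite B" "A \<subseteq> B"
  shows "(\<Sum>C\<in>{A..B}. x ^ card (C - A)) = (1 + x) ^ card (B - A)"
    and "(\<Sum>C\<in>{A..B}. x ^ card (B - C)) = (1 + x) ^ card (B - A)"
proof -
  have *: "(\<Sum>T\<in>Pow (B - A). x ^ card T) = (1 + x) ^ card (B - A)"
    using assms by (intro sum_Pow_power_card) auto
  show "(\<Sum>C\<in>{A..B}. x ^ card (C - A)) = (1 + x) ^ card (B - A)"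
    unfolding *[symmetric] using assms(2)
    by (intro sum.reindex_bij_witness[of _ "\<lambda>T. A \<union> T" "\<lambda>C. C - A"]) (auto intro: arg_cong)
  show "(\<Sum>C\<in>{A..B}. x ^ card (B - C)) = (1 + x) ^ card (B - A)"
    unfolding *[symmetric] using assms(2)
    by (intro sum.reindex_bij_witness[of _ "\<lambda>T. B - T" "\<lambda>C. B - C"]) (auto intro: arg_cong)
qed

lemma finite_set_interval: "finite B \<Longrightarrow> finite {A..B :: 'a set}"
  by (rule finite_subset[of _ "Pow B"]) auto

definition subintervals :: "'a set \<times> 'a set \<Rightarrow> ('a set \<times> 'a set) set" where
  "subintervals y = (SIGMA A:{fst y..snd y}. {A..snd y})"

lemma subintervals_iff: "z \<in> subintervals y \<longleftrightarrow> int_le z y \<and> fst z \<subseteq> snd z"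
  by (cases z) (auto simp: subintervals_def int_le_def)

lemma finite_subintervals: "finite (snd y) \<Longrightarrow> finite (subintervals y)"
  unfolding subintervals_def
  by (intro finite_SigmaI finite_set_interval) auto

text \<open>Each element of \<open>snd y - fst y\<close> lies in the lower set of the subinterval,
  in its difference, or outside its upper set, with weights 1, x and 1. This matches the shift by 2
  in \<open>omega_shift2\<close>.\<close>

lemma sum_subintervals:
  fixes x :: "'b::comm_ring_1"
  assumes "finite (snd y)" "fst y \<subseteq> snd y"
  shows "(\<Sum>z\<in>subintervals y. x ^ card (snd z - fst z)) = (2 + x) ^ card (snd y - fst y)"
proof -
  have "(\<Sum>z\<in>subintervals y. x ^ card (snd z - fst z))
      = (\<Sum>A\<in>{fst y..snd y}. \<Sum>B\<in>{A..snd y}. x ^ card (B - A))"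
    unfolding subintervals_def using assms
    by (subst sum.Sigma) (auto simp: split_def finite_set_interval)
  also have "\<dots> = (\<Sum>A\<in>{fst y..snd y}. (1 + x) ^ card (snd y - A))"
    using assms by (intro sum.cong) (auto simp: sum_interval_power_card)
  also have "\<dots> = (1 + (1 + x)) ^ card (snd y - fst y)"
    using assms by (intro sum_interval_power_card)
  finally show ?thesis by (simp add: add.assoc[symmetric])
qed

lemma int_le_antisym: "int_le x y \<Longrightarrow> int_le y x \<Longrightarrow> x = y"
  by (auto simp: int_le_def prod_eq_iff)

lemma int_le_trans: "int_le x y \<Longrightarrow> int_le y z \<Longrightarrow> int_le x z"
  by (auto simp: int_le_def)

lemma int_le_refl [simp]: "int_le x x"
  by (simp add: int_le_def)

lemma subinterval_eq:
  assumes "int_le z y" "fst z \<subseteq> snd z" "snd z - fst z = snd y - fst y"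
  shows "z = y"
  using assms by (auto simp: int_le_def prod_eq_iff)

text \<open>No ambient complex is fixed: a subinterval has a larger lower and a smaller upper set,
  so for a simplicial complex the chains below an interval of \<open>interval_poset\<close> stay
  inside it.\<close>

definition int_chain :: "('a set \<times> 'a set) set \<Rightarrow> bool" where
  "int_chain C \<longleftrightarrow> finite C \<and> (\<forall>I\<in>C. fst I \<subseteq> snd I) \<and> (\<forall>I\<in>C. \<forall>J\<in>C. int_le I J \<or> int_le J I)"

definition chains_to :: "'a set \<times> 'a set \<Rightarrow> ('a set \<times> 'a set) set set" where
  "chains_to y = {C. int_chain C \<and> y \<in> C \<and> (\<forall>I\<in>C. int_le I y)}"

lemma int_chain_max:
  assumes "int_chain C" "C \<noteq> {}"
  shows "\<exists>z\<in>C. C \<in> chains_to z"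
proof -
  have "\<exists>z\<in>C. \<forall>I\<in>C. int_le I z" if "finite C" "C \<noteq> {}" "\<forall>I\<in>C. \<forall>J\<in>C. int_le I J \<or> int_le J I"
    using that
  proof (induction C rule: finite_ne_induct)
    case (insert x C)
    then obtain z where z: "z \<in> C" "\<forall>I\<in>C. int_le I z" by auto
    show ?case
    proof (cases "int_le x z")
      case False
      then have "int_le z x" using insert.prems z by auto
      then show ?thesis using z by (auto intro: int_le_trans)
    qed (use z in auto)
  qed simp
  then show ?thesis using assms by (auto simp: int_chain_def chains_to_def)
qed

lemma finite_chains_to:
  assumes "finite (snd y)"
  shows "finite (chains_to y)"
proof (rule finite_subset)
  show "chains_to y \<subseteq> Pow (subintervals y)"
    by (auto simp: chains_to_def int_chain_def subintervals_iff)
qed (use finite_subintervals[OF assms] in simp)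

lemma disjoint_chains_to: "y \<noteq> z \<Longrightarrow> chains_to y \<inter> chains_to z = {}"
  by (auto simp: chains_to_def dest: int_le_antisym)

lemma chains_to_eq:
  assumes "fst y \<subseteq> snd y"
  shows "chains_to y = insert y ` insert {} (\<Union>z\<in>subintervals y - {y}. chains_to z)"
proof (intro equalityI subsetI)
  fix C assume C: "C \<in> chains_to y"
  have "C - {y} \<in> insert {} (\<Union>z\<in>subintervals y - {y}. chains_to z)"
  proof (cases "C - {y} = {}")
    case False
    have "int_chain (C - {y})" using C by (auto simp: chains_to_def int_chain_def)
    from int_chain_max[OF this False] obtain z where "z \<in> C - {y}" "C - {y} \<in> chains_to z" by blast
    moreover from this have "z \<in> subintervals y - {y}"
      using C by (auto simp: chains_to_def int_chain_def subintervals_iff)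
    ultimately show ?thesis by blast
  qed simp
  moreover have "C = insert y (C - {y})" using C by (auto simp: chains_to_def)
  ultimately show "C \<in> insert y ` insert {} (\<Union>z\<in>subintervals y - {y}. chains_to z)" by blast
next
  fix C assume "C \<in> insert y ` insert {} (\<Union>z\<in>subintervals y - {y}. chains_to z)"
  then consider "C = {y}" | z D where "z \<in> subintervals y" "D \<in> chains_to z" "C = insert y D"
    by blast
  then show "C \<in> chains_to y"
  proof cases
    case 1
    then show ?thesis using assms by (auto simp: chains_to_def int_chain_def)
  next
    case 2
    then have "int_le I y" if "I \<in> D" for I
      using that by (auto simp: chains_to_def subintervals_iff intro: int_le_trans)
    then show ?thesis
      using 2 assms by (auto simp: chains_to_def int_chain_def)
  qed
qed

lemma sum_disjoint_chains:
  fixes g :: "('a set \<times> 'a set) set \<Rightarrow> real"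
  assumes "finite Z" "\<And>z. z \<in> Z \<Longrightarrow> finite (snd z)"
  shows "sum g (insert {} (\<Union>z\<in>Z. chains_to z)) = g {} + (\<Sum>z\<in>Z. sum g (chains_to z))"
proof -
  have fin: "\<forall>z\<in>Z. finite (chains_to z)" using assms(2) finite_chains_to by blast
  moreover have "{} \<notin> (\<Union>z\<in>Z. chains_to z)" by (auto simp: chains_to_def)
  moreover have "sum g (\<Union>z\<in>Z. chains_to z) = (\<Sum>z\<in>Z. sum g (chains_to z))"
    using assms(1) fin by (intro sum.UNION_disjoint ballI impI disjoint_chains_to) auto
  ultimately show ?thesis using assms(1) by simp
qed

text \<open>Removing the top interval gives a recursion over proper subintervals. The
  \<open>omega\<close> side obeys the same recursion, because summing over all subintervals turns
  X^k into (X + 2)^k.\<close>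

lemma face_sum_chains_to:
  assumes s: "s \<noteq> 1" "s \<noteq> -1" and "finite (snd y)" "fst y \<subseteq> snd y"
  shows "face_sum (chains_to y) (s\<^sup>2 / (1 - s\<^sup>2)) = omega s ([:0, 1:] ^ card (snd y - fst y))"
  using assms(3,4)
proof (induction "card (snd y - fst y)" arbitrary: y rule: less_induct)
  case less
  define Y where "Y = s\<^sup>2 / (1 - s\<^sup>2)"
  define Z where "Z = subintervals y - {y}"
  define k where "k = card (snd y - fst y)"
  have s2: "1 - s\<^sup>2 \<noteq> 0" using s by (simp add: power2_eq_1_iff)
  have Z: "int_le z y" "fst z \<subseteq> snd z" "z \<noteq> y" "finite (snd z)" if "z \<in> Z" for z
    using that less.prems(1) by (auto simp: Z_def subintervals_iff int_le_def intro: finite_subset)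
  have finZ: "finite Z" using less.prems by (simp add: Z_def finite_subintervals)
  have IH: "face_sum (chains_to z) Y = omega s ([:0, 1:] ^ card (snd z - fst z))" if "z \<in> Z" for z
  proof -
    have "snd z - fst z \<subset> snd y - fst y"
      using Z[OF that] subinterval_eq[of z y] by (auto simp: int_le_def)
    then show ?thesis
      unfolding Y_def using Z[OF that] less.prems by (intro less.hyps psubset_card_mono) auto
  qed
  have notin: "y \<notin> D" "finite D" if "D \<in> insert {} (\<Union>z\<in>Z. chains_to z)" for D
  proof -
    show "finite D" using that by (auto simp: chains_to_def int_chain_def)
    show "y \<notin> D"
    proof
      assume "y \<in> D"
      then obtain z where z: "z \<in> Z" "D \<in> chains_to z" using \<open>D \<in> _\<close> by auto
      then have "int_le y z" using \<open>y \<in> D\<close> by (simp add: chains_to_def)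
      then show False using Z[OF z(1)] int_le_antisym by blast
    qed
  qed
  then have inj: "inj_on (insert y) (insert {} (\<Union>z\<in>Z. chains_to z))"
    unfolding inj_on_def by (metis insert_ident)
  have "face_sum (chains_to y) Y = (\<Sum>D\<in>insert {} (\<Union>z\<in>Z. chains_to z). Y ^ card (insert y D))"
    unfolding face_sum_def chains_to_eq[OF less.prems(2)] Z_def[symmetric] by (simp only: sum.reindex[OF inj] o_def)
  also have "\<dots> = (\<Sum>D\<in>insert {} (\<Union>z\<in>Z. chains_to z). Y * Y ^ card D)"
    using notin by (intro sum.cong) auto
  also have "\<dots> = Y * (1 + (\<Sum>z\<in>Z. face_sum (chains_to z) Y))"
    unfolding sum_distrib_left[symmetric] by (subst sum_disjoint_chains) (simp_all add: face_sum_def finZ Z(4))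
  also have "\<dots> = Y * (1 + (\<Sum>z\<in>Z. omega s ([:0, 1:] ^ card (snd z - fst z))))"
    using IH by simp
  finally have W: "face_sum (chains_to y) Y = \<dots>" .
  have "subintervals y = insert y Z" "y \<notin> Z"
    using less.prems by (auto simp: Z_def subintervals_iff)
  then have "omega s ([:0, 1:] ^ k) + (\<Sum>z\<in>Z. omega s ([:0, 1:] ^ card (snd z - fst z)))
      = omega s (\<Sum>z\<in>subintervals y. [:0, 1:] ^ card (snd z - fst z))"
    unfolding omega_sum using finZ by (simp add: k_def)
  also have "(\<Sum>z\<in>subintervals y. [:0, 1:] ^ card (snd z - fst z)) = [:0, 1::real:] ^ k \<circ>\<^sub>p [:2, 1:]"
    unfolding sum_subintervals[OF less.prems] k_def[symmetric]
    by (rule poly_ext) (simp add: poly_pcompose)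
  finally have "omega s ([:0, 1:] ^ k) = s\<^sup>2 + s\<^sup>2 *
      (omega s ([:0, 1:] ^ k) + (\<Sum>z\<in>Z. omega s ([:0, 1:] ^ card (snd z - fst z))))"
    using omega_shift2[OF s, of "[:0, 1:] ^ k"] by simp
  \<comment> \<open>The unknown also occurs on the right, as the summand of y itself; solving for it
    produces the factor \<open>Y\<close>.\<close>
  then have "omega s ([:0, 1:] ^ k) = Y * (1 + (\<Sum>z\<in>Z. omega s ([:0, 1:] ^ card (snd z - fst z))))"
    using s2 unfolding Y_def by (simp add: field_simps)
  then show ?case using W by (simp add: Y_def k_def)
qed

lemma interval_poset_iff: "I \<in> interval_poset \<Delta> \<longleftrightarrow> fst I \<noteq> {} \<and> fst I \<subseteq> snd I \<and> snd I \<in> \<Delta>"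
  by (simp add: interval_poset_def split_def)

lemma interval_subdivision_eq:
  "interval_subdivision \<Delta> = insert {} (\<Union>y\<in>interval_poset \<Delta>. chains_to y)"
  if "simplicial_complex \<Delta>"
proof (intro equalityI subsetI)
  fix C assume C: "C \<in> interval_subdivision \<Delta>"
  show "C \<in> insert {} (\<Union>y\<in>interval_poset \<Delta>. chains_to y)"
  proof (cases "C = {}")
    case False
    have "fst I \<subseteq> snd I" if "I \<in> C" for I
    proof -
      have "I \<in> interval_poset \<Delta>" using that C by (auto simp: interval_subdivision_def)
      then show ?thesis by (simp add: interval_poset_iff)
    qed
    then have "int_chain C"
      using C by (simp add: interval_subdivision_def int_chain_def)
    from int_chain_max[OF this False] show ?thesis
      using C by (auto simp: interval_subdivision_def)
  qed simp
next
  fix C assume "C \<in> insert {} (\<Union>y\<in>interval_poset \<Delta>. chains_to y)"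
  then consider "C = {}" | y where "y \<in> interval_poset \<Delta>" "C \<in> chains_to y" by blast
  then show "C \<in> interval_subdivision \<Delta>"
  proof cases
    case 1
    then show ?thesis by (simp add: interval_subdivision_def)
  next
    case 2
    have "I \<in> interval_poset \<Delta>" if "I \<in> C" for I
    proof -
      have y: "fst y \<noteq> {}" "snd y \<in> \<Delta>" using 2 by (simp_all add: interval_poset_iff)
      have I: "fst I \<subseteq> snd I" "fst y \<subseteq> fst I" "snd I \<subseteq> snd y"
        using 2(2) that by (auto simp: chains_to_def int_chain_def int_le_def)
      then have "snd I \<in> \<Delta>"
        using y(2) \<open>simplicial_complex \<Delta>\<close> unfolding simplicial_complex_def by blast
      then show ?thesis using y I by (auto simp: interval_poset_iff)
    qed
    then show ?thesis
      using 2 by (auto simp: interval_subdivision_def chains_to_def int_chain_def)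
  qed
qed

lemma interval_poset_Sigma:
  "sum g (interval_poset \<Delta>) = (\<Sum>B\<in>\<Delta>. \<Sum>A\<in>{{}..B} - {{}}. g (A, B))"
  if "simplicial_complex \<Delta>" for g :: "_ \<Rightarrow> real"
proof -
  have fin: "finite B" if "B \<in> \<Delta>" for B
    using that \<open>simplicial_complex \<Delta>\<close> by (simp add: simplicial_complex_def)
  have "(\<Sum>B\<in>\<Delta>. \<Sum>A\<in>{{}..B} - {{}}. g (A, B)) = (\<Sum>(B, A)\<in>(SIGMA B:\<Delta>. {{}..B} - {{}}). g (A, B))"
    using \<open>simplicial_complex \<Delta>\<close> fin
    by (subst sum.Sigma) (auto simp: simplicial_complex_def finite_set_interval)
  also have "\<dots> = sum g (interval_poset \<Delta>)"
    by (rule sum.reindex_bij_witness[of _ prod.swap prod.swap]) (auto simp: interval_poset_def)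
  finally show ?thesis by simp
qed

lemma finite_interval_poset:
  assumes "simplicial_complex \<Delta>"
  shows "finite (interval_poset \<Delta>)"
proof (rule finite_subset)
  show "interval_poset \<Delta> \<subseteq> \<Delta> \<times> \<Delta>"
    using assms by (auto simp: interval_poset_def simplicial_complex_def)
qed (use assms in \<open>simp add: simplicial_complex_def\<close>)

lemma finite_interval_subdivision:
  assumes "simplicial_complex \<Delta>"
  shows "finite (interval_subdivision \<Delta>)"
proof (rule finite_subset)
  show "interval_subdivision \<Delta> \<subseteq> Pow (interval_poset \<Delta>)"
    by (auto simp: interval_subdivision_def)
qed (use finite_interval_poset[OF assms] in simp)

text \<open>Chains are sorted by their largest interval. As \<open>omega\<close> reads values at 2m
  - 1, the two terms stand for phi(2m) and phi(2m - 1), with phi the face polynomial.\<close>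

lemma face_sum_interval_subdivision:
  assumes \<Delta>: "simplicial_complex \<Delta>" and s: "s \<noteq> 1" "s \<noteq> -1"
  shows "face_sum (interval_subdivision \<Delta>) (s\<^sup>2 / (1 - s\<^sup>2))
     = 1 + omega s ((\<Sum>B\<in>\<Delta>. [:0, 1:] ^ card B) \<circ>\<^sub>p [:1, 1:]) - omega s (\<Sum>B\<in>\<Delta>. [:0, 1:] ^ card B)"
proof -
  let ?X = "[:0, 1::real:]"
  have fin: "finite (snd y)" "fst y \<subseteq> snd y" if "y \<in> interval_poset \<Delta>" for y
    using that \<Delta> by (auto simp: interval_poset_def simplicial_complex_def)
  have "face_sum (interval_subdivision \<Delta>) (s\<^sup>2 / (1 - s\<^sup>2))
     = 1 + (\<Sum>y\<in>interval_poset \<Delta>. face_sum (chains_to y) (s\<^sup>2 / (1 - s\<^sup>2)))"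
    unfolding face_sum_def interval_subdivision_eq[OF \<Delta>]
    by (subst sum_disjoint_chains) (simp_all add: finite_interval_poset[OF \<Delta>] fin)
  also have "(\<Sum>y\<in>interval_poset \<Delta>. face_sum (chains_to y) (s\<^sup>2 / (1 - s\<^sup>2)))
     = (\<Sum>y\<in>interval_poset \<Delta>. omega s (?X ^ card (snd y - fst y)))"
    by (intro sum.cong refl face_sum_chains_to[OF s] fin)
  also have "\<dots> = (\<Sum>B\<in>\<Delta>. omega s ([:1, 1:] ^ card B - ?X ^ card B))"
    unfolding interval_poset_Sigma[OF \<Delta>]
  proof (rule sum.cong)
    fix B assume "B \<in> \<Delta>"
    then have "finite B" using \<Delta> by (simp add: simplicial_complex_def)
    then have finI: "finite {{}..B}" by (rule finite_set_interval)
    \<comment> \<open>The subtracted power accounts for the empty lower set, which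
      \<open>interval_poset\<close> excludes.\<close>
    have "(\<Sum>A\<in>{{}..B} - {{}}. ?X ^ card (B - A)) = (1 + ?X) ^ card B - ?X ^ card B"
      using sum_interval_power_card(2)[OF \<open>finite B\<close>, of "{}" ?X] finI
      by (simp add: sum_diff1)
    then show "(\<Sum>A\<in>{{}..B} - {{}}. omega s (?X ^ card (snd (A, B) - fst (A, B))))
        = omega s ([:1, 1:] ^ card B - ?X ^ card B)"
      by (simp add: omega_sum[symmetric] one_pCons)
  qed simp
  also have "\<dots> = omega s (\<Sum>B\<in>\<Delta>. [:1, 1:] ^ card B) - omega s (\<Sum>B\<in>\<Delta>. ?X ^ card B)"
    by (simp add: omega_sum omega_diff sum_subtractf)
  also have "(\<Sum>B\<in>\<Delta>. [:1, 1:] ^ card B) = (\<Sum>B\<in>\<Delta>. ?X ^ card B) \<circ>\<^sub>p [:1, 1:]"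
    by (rule poly_ext) (simp add: poly_pcompose poly_sum)
  finally show ?thesis by simp
qed

section \<open>Dimension of the interval subdivision\<close>

lemma ex_maximal_flag:
  assumes "finite S"
  shows "\<exists>C\<subseteq>Pow S. card C = Suc (card S) \<and> (\<forall>X\<in>C. \<forall>Y\<in>C. X \<subseteq> Y \<or> Y \<subseteq> X)"
  using assms
proof (induction S rule: finite_induct)
  case empty
  then show ?case by (intro exI[of _ "{{}}"]) auto
next
  case (insert a S)
  then obtain C where C: "C \<subseteq> Pow S" "card C = Suc (card S)" "\<forall>X\<in>C. \<forall>Y\<in>C. X \<subseteq> Y \<or> Y \<subseteq> X"
    by blast
  have "finite C" using C(2) card.infinite by fastforce
  moreover have "insert a S \<notin> C" using C(1) insert.hyps by auto
  ultimately show ?case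
    using C insert.hyps by (intro exI[of _ "insert (insert a S) C"]) auto
qed

text \<open>Along a chain the size of \<open>snd I - fst I\<close> strictly increases, and it stays
  below \<open>cdim\<close> because lower sets are nonempty.\<close>

lemma card_interval_chain:
  assumes \<Delta>: "simplicial_complex \<Delta>" and C: "C \<in> interval_subdivision \<Delta>"
  shows "card C \<le> cdim \<Delta>"
proof -
  have fin\<Delta>: "finite \<Delta>" using \<Delta> by (simp add: simplicial_complex_def)
  have P: "fst I \<noteq> {}" "fst I \<subseteq> snd I" "snd I \<in> \<Delta>" "finite (snd I)" if "I \<in> C" for I
  proof -
    have "I \<in> interval_poset \<Delta>" using that C by (auto simp: interval_subdivision_def)
    then show "fst I \<noteq> {}" "fst I \<subseteq> snd I" "snd I \<in> \<Delta>" "finite (snd I)"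
      using \<Delta> by (simp_all add: interval_poset_iff simplicial_complex_def)
  qed
  have eq: "I = J" if IJ: "I \<in> C" "J \<in> C" "int_le I J" "card (snd I - fst I) = card (snd J - fst J)" for I J
  proof (rule subinterval_eq[OF IJ(3) P(2)[OF IJ(1)]])
    show "snd I - fst I = snd J - fst J"
      using IJ P(4)[OF IJ(2)] by (intro card_subset_eq) (auto simp: int_le_def)
  qed
  have "inj_on (\<lambda>I. card (snd I - fst I)) C"
  proof (rule inj_onI)
    fix I J assume "I \<in> C" "J \<in> C" "card (snd I - fst I) = card (snd J - fst J)"
    then show "I = J"
      using eq[of I J] eq[of J I] C by (auto simp: interval_subdivision_def)
  qed
  moreover have "(\<lambda>I. card (snd I - fst I)) ` C \<subseteq> {..<cdim \<Delta>}"
  proof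
    fix n assume "n \<in> (\<lambda>I. card (snd I - fst I)) ` C"
    then obtain I where I: "I \<in> C" "n = card (snd I - fst I)" by blast
    have "card (snd I - fst I) < card (snd I)"
      using P[OF I(1)] by (intro psubset_card_mono) auto
    also have "\<dots> \<le> cdim \<Delta>" by (rule card_le_cdim[OF fin\<Delta> P(3)[OF I(1)]])
    finally show "n \<in> {..<cdim \<Delta>}" using I by simp
  qed
  ultimately show ?thesis using card_inj_on_le[of _ C "{..<cdim \<Delta>}"] by auto
qed

lemma cdim_interval_subdivision:
  assumes \<Delta>: "simplicial_complex \<Delta>"
  shows "cdim (interval_subdivision \<Delta>) = cdim \<Delta>"
proof -
  have "cdim \<Delta> \<in> card ` \<Delta>"
    unfolding cdim_def using \<Delta> by (intro Max_in) (auto simp: simplicial_complex_def)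
  then obtain F where F: "F \<in> \<Delta>" "card F = cdim \<Delta>" by auto
  have "finite F" using F \<Delta> by (simp add: simplicial_complex_def)
  have "\<exists>C\<in>interval_subdivision \<Delta>. card C = cdim \<Delta>"
  proof (cases "F = {}")
    case True
    then show ?thesis using F by (intro bexI[of _ "{}"]) (auto simp: interval_subdivision_def)
  next
    case False
    then obtain a where a: "a \<in> F" by blast
    obtain C where C: "C \<subseteq> Pow (F - {a})" "card C = Suc (card (F - {a}))"
      "\<forall>X\<in>C. \<forall>Y\<in>C. X \<subseteq> Y \<or> Y \<subseteq> X"
      using ex_maximal_flag[of "F - {a}"] \<open>finite F\<close> by blast
    have "finite C" using C(2) card.infinite by fastforce
    \<comment> \<open>The intervals from {a} to the members of a maximal flag between {a} and F form
      a chain with \<open>card F\<close> elements.\<close>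
    let ?g = "\<lambda>X. ({a}, insert a X)"
    have CX: "a \<notin> X" "insert a X \<subseteq> F" if "X \<in> C" for X
      using that C(1) a by auto
    have "inj_on ?g C"
    proof (rule inj_onI)
      fix X Y assume "X \<in> C" "Y \<in> C" "?g X = ?g Y"
      then show "X = Y" using insert_ident[OF CX(1) CX(1), of X Y] by simp
    qed
    then have "card (?g ` C) = cdim \<Delta>"
      by (simp only: card_image C(2) card_Suc_Diff1[OF \<open>finite F\<close> a] F(2))
    moreover have "?g ` C \<subseteq> interval_poset \<Delta>"
      using CX(2) F(1) \<Delta> by (auto simp: interval_poset_def simplicial_complex_def)
    moreover have "int_le I J \<or> int_le J I" if IJ: "I \<in> ?g ` C" "J \<in> ?g ` C" for I J
    proof -
      obtain X Y where "X \<in> C" "Y \<in> C" "I = ?g X" "J = ?g Y" using IJ by blast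
      then show ?thesis using C(3) by (auto simp: int_le_def)
    qed
    ultimately show ?thesis
      using \<open>finite C\<close> by (intro bexI[of _ "?g ` C"]) (auto simp: interval_subdivision_def)
  qed
  then have "cdim \<Delta> \<in> card ` interval_subdivision \<Delta>" by (metis imageI)
  then show ?thesis
    unfolding cdim_def[of "interval_subdivision \<Delta>"]
    using card_interval_chain[OF \<Delta>] finite_interval_subdivision[OF \<Delta>] by (intro Max_eqI) auto
qed

section \<open>The h-polynomial of the subdivision as an even part\<close>

lemma lam_face_poly:
  assumes \<Delta>: "simplicial_complex \<Delta>" and s: "s \<noteq> 1"
  shows "(1 - s) ^ Suc (cdim \<Delta>) * lam s (\<Sum>B\<in>\<Delta>. [:0, 1:] ^ card B)
     = (\<Sum>l\<le>cdim \<Delta>. of_int (h_vec \<Delta> l) * restricted_eulerian s (cdim \<Delta>) l)"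
proof -
  \<comment> \<open>\<open>face_sum_h_vec\<close> becomes a polynomial identity, as agreement on the
    open unit interval suffices.\<close>
  have "(\<Sum>B\<in>\<Delta>. [:0, 1:] ^ card B)
    = (\<Sum>l\<le>cdim \<Delta>. smult (of_int (h_vec \<Delta> l)) ([:0, 1:] ^ l * [:1, 1::real:] ^ (cdim \<Delta> - l)))"
  proof (rule real_poly_eqI)
    fix x :: real assume "0 < x" "x < 1"
    then show "poly (\<Sum>B\<in>\<Delta>. [:0, 1:] ^ card B) x
      = poly (\<Sum>l\<le>cdim \<Delta>. smult (of_int (h_vec \<Delta> l)) ([:0, 1:] ^ l * [:1, 1:] ^ (cdim \<Delta> - l))) x"
      using face_sum_h_vec[of \<Delta> x] \<Delta>
      by (simp add: poly_sum face_sum_def simplicial_complex_def)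
  qed
  then have "(1 - s) ^ Suc (cdim \<Delta>) * lam s (\<Sum>B\<in>\<Delta>. [:0, 1:] ^ card B)
    = (\<Sum>l\<le>cdim \<Delta>. of_int (h_vec \<Delta> l) *
        ((1 - s) ^ Suc (cdim \<Delta>) * lam s ([:0, 1:] ^ l * [:1, 1:] ^ (cdim \<Delta> - l))))"
    by (simp only: lam_sum lam_smult sum_distrib_left mult.left_commute)
  then show ?thesis
    using lam_restricted_eulerian[OF s] by simp
qed

text \<open>As phi(0) = 1, the shift rule expresses the transform of phi(X + 1) through that of phi,
  and the constants cancel. Splitting (1 - s^2)^d into (1 - s)^d (1 + s)^d supplies the powers for
  \<open>lam_face_poly\<close> at s and -s.\<close>

lemma h_poly_interval_subdivision:
  assumes \<Delta>: "simplicial_complex \<Delta>" and s: "s \<noteq> 1" "s \<noteq> -1"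
  defines "hb \<equiv> \<lambda>s. \<Sum>l\<le>cdim \<Delta>. of_int (h_vec \<Delta> l) * restricted_eulerian s (cdim \<Delta>) l"
  shows "poly (map_poly real_of_int (h_poly (interval_subdivision \<Delta>))) (s\<^sup>2)
     = ((1 + s) ^ cdim \<Delta> * hb s + (1 - s) ^ cdim \<Delta> * hb (- s)) / 2"
proof -
  define \<phi> where "\<phi> = (\<Sum>B\<in>\<Delta>. [:0, 1::real:] ^ card B)"
  define d where "d = cdim \<Delta>"
  have "poly \<phi> 0 = (\<Sum>B\<in>\<Delta>. if B = {} then 1 else 0)"
    unfolding \<phi>_def poly_sum using \<Delta> by (intro sum.cong) (auto simp: simplicial_complex_def power_0_left)
  then have \<phi>0: "poly \<phi> 0 = 1" using \<Delta> by (simp add: simplicial_complex_def)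
  have sh: "r * lam r (\<phi> \<circ>\<^sub>p [:1, 1:]) = lam r \<phi> - 1" if "r \<noteq> 1" for r
    using lam_shift[OF that, of \<phi>] \<phi>0 by simp
  have s2: "s\<^sup>2 \<noteq> 1" using s by (simp add: power2_eq_1_iff)
  have "poly (map_poly real_of_int (h_poly (interval_subdivision \<Delta>))) (s\<^sup>2)
     = (1 - s\<^sup>2) ^ d * (1 + omega s (\<phi> \<circ>\<^sub>p [:1, 1:]) - omega s \<phi>)"
    using poly_h_poly[OF finite_interval_subdivision[OF \<Delta>] s2]
    by (simp add: face_sum_interval_subdivision[OF \<Delta> s] cdim_interval_subdivision[OF \<Delta>] \<phi>_def d_def)
  also have "1 + omega s (\<phi> \<circ>\<^sub>p [:1, 1:]) - omega s \<phi> = ((1 - s) * lam s \<phi> + (1 + s) * lam (- s) \<phi>) / 2"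
    using sh[of s] sh[of "- s"] s by (simp add: omega_def field_simps)
  also have "(1 - s\<^sup>2) ^ d * (((1 - s) * lam s \<phi> + (1 + s) * lam (- s) \<phi>) / 2)
     = ((1 + s) ^ d * ((1 - s) ^ Suc d * lam s \<phi>) + (1 - s) ^ d * ((1 - - s) ^ Suc d * lam (- s) \<phi>)) / 2"
  proof -
    have "(1 - s\<^sup>2) ^ d = (1 - s) ^ d * (1 + s) ^ d"
      by (simp add: power_mult_distrib[symmetric] power2_eq_square algebra_simps)
    then show ?thesis by (simp only:) (simp add: field_simps)
  qed
  also have "\<dots> = ((1 + s) ^ d * hb s + (1 - s) ^ d * hb (- s)) / 2"
    using lam_face_poly[OF \<Delta>, of s] lam_face_poly[OF \<Delta>, of "- s"] s
    by (simp only: \<phi>_def d_def hb_def) simp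
  finally show ?thesis by (simp add: d_def)
qed

section \<open>The \<open>\<gamma>\<close>-vector of the interval subdivision\<close>

lemma h_vec_0:
  assumes "simplicial_complex \<Delta>"
  shows "h_vec \<Delta> 0 = 1"
proof -
  have "face_sum \<Delta> 0 = (\<Sum>B\<in>\<Delta>. if B = {} then 1 else 0)"
    unfolding face_sum_def using assms by (intro sum.cong) (auto simp: simplicial_complex_def power_0_left)
  then have "face_sum \<Delta> 0 = 1" using assms by (simp add: simplicial_complex_def)
  then have "poly (map_poly real_of_int (h_poly \<Delta>)) 0 = 1"
    using assms by (simp add: poly_h_poly simplicial_complex_def)
  then show ?thesis
    by (simp add: poly_0_coeff_0 coeff_map_poly h_vec_def)
qed

text \<open>Symmetry lets the sum fold with one coefficient per pair. The pair at index 0 has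
  coefficient h_0 = 1 and gives the \<open>gam_r\<close> term; the others are covered by
  \<open>gam_u\<close>.\<close>

lemma symmetric_h_sum:
  assumes \<Delta>: "simplicial_complex \<Delta>" and sym: "h_symmetric \<Delta>" and d: "cdim \<Delta> = Suc n" and s: "s \<noteq> 0"
    and z: "z = s / (1 + s\<^sup>2)"
  shows "(1 + s) ^ cdim \<Delta> * (\<Sum>l\<le>cdim \<Delta>. of_int (h_vec \<Delta> l) * restricted_eulerian s (cdim \<Delta>) l)
    = (1 + s\<^sup>2) ^ cdim \<Delta> * ((1 + 2 * z) * gam_r n 0 z
        + z * (\<Sum>l=1..Suc n div 2. of_int (h_vec \<Delta> l) * gam_u n l z))"
proof -
  let ?E = "restricted_eulerian s (Suc n)"
  let ?U = "fold_sym ?E (Suc n)"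
  let ?h = "\<lambda>l. of_int (h_vec \<Delta> l) :: real"
  have v: "1 + s\<^sup>2 \<noteq> 0" using zero_le_power2[of s] by linarith
  have "(\<Sum>l\<le>Suc n. ?h l * ?E l) = (\<Sum>l=0..Suc n div 2. fold_sym (\<lambda>l. ?h l * ?E l) (Suc n) l)"
    using sum_fold_sym[of 0 "Suc n" "\<lambda>l. ?h l * ?E l"] by (simp only: atMost_atLeast0 diff_zero)
  also have "\<dots> = (\<Sum>l=0..Suc n div 2. ?h l * ?U l)"
  proof (rule sum.cong)
    fix l assume "l \<in> {0..Suc n div 2}"
    then have "l \<le> cdim \<Delta>" using d by simp
    then have "h_vec \<Delta> (Suc n - l) = h_vec \<Delta> l"
      using sym unfolding h_symmetric_def d by metis
    then show "fold_sym (\<lambda>l. ?h l * ?E l) (Suc n) l = ?h l * ?U l"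
      by (simp add: fold_sym_def algebra_simps del: restricted_eulerian.simps)
  qed simp
  also have "\<dots> = ?U 0 + (\<Sum>l=1..Suc n div 2. ?h l * ?U l)"
    by (simp add: sum.atLeast_Suc_atMost h_vec_0[OF \<Delta>])
  finally have sum_eq: "(\<Sum>l\<le>Suc n. ?h l * ?E l) = ?U 0 + (\<Sum>l=1..Suc n div 2. ?h l * ?U l)" .
  have w: "(1 + s)\<^sup>2 = (1 + s\<^sup>2) * (1 + 2 * z)" and zv: "s * x = (1 + s\<^sup>2) * (z * x)" for x
    using v unfolding z by (simp_all add: field_simps power2_eq_square)
  have U0: "?U 0 = (1 + s) * ?E 0"
    using restricted_eulerian_top[of s n] by (simp add: fold_sym_def algebra_simps del: restricted_eulerian.simps)
  \<comment> \<open>At index 0 the quantity treated in \<open>eulerian_pairs_eq_gam\<close> is 2 s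
    times \<open>?E 0\<close>; the factor is cancelled next, using that s is nonzero.\<close>
  have "2 * s * ((1 + s) ^ n * ?E 0) = 2 * s * ((1 + s\<^sup>2) ^ n * gam_r n 0 z)"
    using eulerian_pairs_eq_gam(1)[OF z, of 0 n] restricted_eulerian_top[of s n]
    by (simp add: algebra_simps del: restricted_eulerian.simps)
  then have E0: "(1 + s) ^ n * ?E 0 = (1 + s\<^sup>2) ^ n * gam_r n 0 z"
    using s by (simp del: restricted_eulerian.simps)
  have "(1 + s) ^ Suc n * ?U 0 = (1 + s)\<^sup>2 * ((1 + s) ^ n * ?E 0)"
    unfolding U0 by (simp add: power2_eq_square algebra_simps del: restricted_eulerian.simps)
  also have "\<dots> = (1 + s\<^sup>2) ^ Suc n * ((1 + 2 * z) * gam_r n 0 z)"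
    unfolding E0 w by simp
  finally have first: "(1 + s) ^ Suc n * ?U 0 = (1 + s\<^sup>2) ^ Suc n * ((1 + 2 * z) * gam_r n 0 z)" .
  have "(1 + s) ^ Suc n * (\<Sum>l=1..Suc n div 2. ?h l * ?U l)
      = (\<Sum>l=1..Suc n div 2. ?h l * ((1 + s) ^ Suc n * ?U l))"
    by (simp only: sum_distrib_left mult.left_commute)
  also have "\<dots> = (\<Sum>l=1..Suc n div 2. ?h l * (s * (1 + s\<^sup>2) ^ n * gam_u n l z))"
    by (intro sum.cong refl arg_cong2[where f = "(*)"] eulerian_pairs_eq_gam(2)[OF z]) auto
  also have "\<dots> = (1 + s\<^sup>2) ^ n * (s * (\<Sum>l=1..Suc n div 2. ?h l * gam_u n l z))"
    unfolding sum_distrib_left by (rule sum.cong) auto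
  also have "\<dots> = (1 + s\<^sup>2) ^ Suc n * (z * (\<Sum>l=1..Suc n div 2. ?h l * gam_u n l z))"
    unfolding zv by simp
  finally show ?thesis
    unfolding d sum_eq distrib_left first by simp
qed

text \<open>The formula of \<open>symmetric_h_sum\<close> is one more growth step: two vertices over
  K and, for each l \<ge> 1, h_l copies of the links that realise \<open>gam_u n l\<close>.
  Nonnegativity makes h_l a number of copies.\<close>

lemma ex_rainbow_complex:
  assumes \<Delta>: "simplicial_complex \<Delta>" and nonneg: "h_nonneg \<Delta>" and sym: "h_symmetric \<Delta>"
  shows "\<exists>K :: vertex set set. rainbow (cdim \<Delta>) fst K \<and> (\<exists>F\<in>K. card F = cdim \<Delta>) \<and>
    (\<forall>s. s \<noteq> 0 \<longrightarrow>
      (1 + s) ^ cdim \<Delta> * (\<Sum>l\<le>cdim \<Delta>. of_int (h_vec \<Delta> l) * restricted_eulerian s (cdim \<Delta>) l)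
        = (1 + s\<^sup>2) ^ cdim \<Delta> * face_sum K (s / (1 + s\<^sup>2)))"
proof (cases "cdim \<Delta>")
  case 0
  then show ?thesis
    by (intro exI[of _ "{{}}"])
       (simp add: face_sum_def rainbow_def simplicial_complex_def h_vec_0[OF \<Delta>])
next
  case (Suc n)
  obtain K :: "vertex set set" and F where K: "rainbow n fst K" and F: "F \<in> K" "card F = n"
    and r0: "gam_r n 0 = face_sum K" and u: "\<And>l. subcomplex_sum K (gam_u n l)"
    using ex_gam_complex[of n] by blast
  define m where "m = Suc n div 2"
  define p where "p l = (\<lambda>z. of_nat (nat (h_vec \<Delta> l)) * gam_u n l z)" for l
  have p: "subcomplex_sum K (p l)" for l
    unfolding p_def by (rule subcomplex_sum_of_nat[OF u])
  obtain L where L: "L 0 = [K, K]" "\<And>j. j \<le> m \<Longrightarrow> set (L j) \<subseteq> subcomplexes K"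
    and fs: "\<And>l z. 1 \<le> l \<Longrightarrow> face_sum (add_vertices n K (insert 0 {l..m}) L) z
        = (1 + 2 * z) * face_sum K z + z * (\<Sum>j=l..m. p j z)"
    by (rule ex_add_vertices[OF K, of m p]) (rule p, rule that)
  define N where "N = add_vertices n K (insert 0 {1..m}) L"
  have "rainbow (Suc n) fst N"
    unfolding N_def using L(2) by (intro rainbow_add_vertices[OF K]) auto
  moreover have "\<exists>F'\<in>N. card F' = Suc n"
    using ex_face_add_vertices[OF K F(1), of "insert 0 {1..m}" L] L(1) F(2) by (simp add: N_def)
  moreover have "(1 + s) ^ cdim \<Delta> * (\<Sum>l\<le>cdim \<Delta>. of_int (h_vec \<Delta> l) * restricted_eulerian s (cdim \<Delta>) l)
        = (1 + s\<^sup>2) ^ cdim \<Delta> * face_sum N (s / (1 + s\<^sup>2))" if "s \<noteq> 0" for s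
  proof -
    define z where "z = s / (1 + s\<^sup>2)"
    have "(\<Sum>l=1..m. p l z) = (\<Sum>l=1..Suc n div 2. of_int (h_vec \<Delta> l) * gam_u n l z)"
      unfolding m_def
    proof (rule sum.cong)
      fix l assume "l \<in> {1..Suc n div 2}"
      then have "l \<le> cdim \<Delta>" using Suc by auto
      then have "h_vec \<Delta> l \<ge> 0" using nonneg by (simp add: h_nonneg_def)
      then show "p l z = of_int (h_vec \<Delta> l) * gam_u n l z" by (simp add: p_def)
    qed simp
    then show ?thesis
      unfolding symmetric_h_sum[OF \<Delta> sym Suc that z_def] z_def[symmetric] N_def fs[OF order_refl] r0
      by simp
  qed
  ultimately show ?thesis unfolding Suc by blast
qed

text \<open>For 2 i \<le> d one has t^i (1 + t)^(d - 2i) = (1 + t)^d (t / (1 + t)^2)^i, so the gamma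
  expansion is an f-polynomial at t / (1 + t)^2. The dimension bound ensures that no face is left
  out.\<close>

lemma is_gamma_vectorI:
  assumes dim: "cdim \<Gamma> \<le> cdim X div 2" and "finite \<Gamma>"
    and eq: "\<And>t. 0 < t \<Longrightarrow> t < 1 \<Longrightarrow> poly (map_poly real_of_int (h_poly X)) t
       = (1 + t) ^ cdim X * face_sum \<Gamma> (t / (1 + t)\<^sup>2)"
  shows "is_gamma_vector X (\<lambda>i. int (fnum \<Gamma> i))"
proof -
  define d where "d = cdim X"
  define q where "q = (\<Sum>i\<le>d div 2. smult (int (fnum \<Gamma> i)) (monom 1 i * [:1, 1:] ^ (d - 2 * i)))"
  have "map_poly real_of_int (h_poly X) = map_poly real_of_int q"
  proof (rule real_poly_eqI)
    fix t :: real assume t: "0 < t" "t < 1"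
    have "poly (map_poly real_of_int q) t = (\<Sum>i\<le>d div 2. real (fnum \<Gamma> i) * (t ^ i * (1 + t) ^ (d - 2 * i)))"
      unfolding q_def
      by (simp add: map_of_int_poly_sum map_of_int_poly_mult map_of_int_poly_power map_poly_smult
          map_poly_monom map_poly_pCons poly_sum poly_monom algebra_simps)
    also have "\<dots> = (1 + t) ^ d * (\<Sum>i\<le>d div 2. real (fnum \<Gamma> i) * (t / (1 + t)\<^sup>2) ^ i)"
      unfolding sum_distrib_left
    proof (rule sum.cong)
      fix i assume "i \<in> {..d div 2}"
      then have "2 * i \<le> d" by auto
      then show "real (fnum \<Gamma> i) * (t ^ i * (1 + t) ^ (d - 2 * i))
          = (1 + t) ^ d * (real (fnum \<Gamma> i) * (t / (1 + t)\<^sup>2) ^ i)"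
        using t by (simp add: power_divide power_diff power_mult)
    qed simp
    also have "(\<Sum>i\<le>d div 2. real (fnum \<Gamma> i) * (t / (1 + t)\<^sup>2) ^ i) = face_sum \<Gamma> (t / (1 + t)\<^sup>2)"
      using dim card_le_cdim[OF \<open>finite \<Gamma>\<close>] order_trans
      by (intro face_sum_fnum[symmetric] \<open>finite \<Gamma>\<close>) (auto simp: d_def)
    finally show "poly (map_poly real_of_int (h_poly X)) t = poly (map_poly real_of_int q) t"
      using eq[OF t] by (simp add: d_def)
  qed
  then have "coeff (map_poly real_of_int (h_poly X)) i = coeff (map_poly real_of_int q) i" for i
    by simp
  then have "h_poly X = q"
    by (intro poly_eqI) (simp add: coeff_map_poly)
  then show ?thesis by (simp add: is_gamma_vector_def q_def d_def)
qed

theorem theorem1p3: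
  fixes \<Delta> :: "'a set set"
  assumes "simplicial_complex \<Delta>" and "h_nonneg \<Delta>" and "h_symmetric \<Delta>"
  shows "\<exists>\<Gamma> :: nat set set. simplicial_complex \<Gamma> \<and> balanced \<Gamma> \<and>
           cdim \<Gamma> \<le> cdim (interval_subdivision \<Delta>) div 2 \<and>
           is_gamma_vector (interval_subdivision \<Delta>) (\<lambda>i. int (fnum \<Gamma> i))"
proof -
  let ?d = "cdim \<Delta>"
  let ?hb = "\<lambda>s. \<Sum>l\<le>?d. of_int (h_vec \<Delta> l) * restricted_eulerian s ?d l"
  obtain K :: "vertex set set" and F where K: "rainbow ?d fst K" and F: "F \<in> K" "card F = ?d"
    and hb: "\<And>s. s \<noteq> 0 \<Longrightarrow> (1 + s) ^ ?d * ?hb s = (1 + s\<^sup>2) ^ ?d * face_sum K (s / (1 + s\<^sup>2))"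
    using ex_rainbow_complex[OF assms] by blast
  obtain Q where Q: "Q \<in> pair_complex fst K" "card Q = ?d div 2"
    using ex_face_pair_complex[OF K F] by blast
  obtain \<Gamma> :: "nat set set" where \<Gamma>: "simplicial_complex \<Gamma>" "balanced \<Gamma>" "cdim \<Gamma> = ?d div 2"
    and fs: "face_sum \<Gamma> = face_sum (pair_complex fst K)"
    using ex_nat_complex[OF rainbow_pair_complex[OF K] Q] by blast
  have "poly (map_poly real_of_int (h_poly (interval_subdivision \<Delta>))) t
      = (1 + t) ^ ?d * face_sum \<Gamma> (t / (1 + t)\<^sup>2)" if t: "0 < t" "t < 1" for t
  proof -
    \<comment> \<open>With this s the square of z is t / (1 + t)^2, the argument in
      \<open>is_gamma_vectorI\<close>.\<close>
    define s where "s = sqrt t"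
    define z where "z = s / (1 + s\<^sup>2)"
    have "s > 0" using t by (simp add: s_def)
    then have s: "s \<noteq> 0" "s \<noteq> -1" by auto
    have s': "s\<^sup>2 = t" "s \<noteq> 1" using t by (auto simp: s_def)
    \<comment> \<open>Replacing s by -s changes z to -z and fixes 1 + s^2, so the average below
      extracts the even part of the face sum of K.\<close>
    have hbm: "(1 - s) ^ ?d * ?hb (- s) = (1 + s\<^sup>2) ^ ?d * face_sum K (- z)"
      using hb[of "- s"] s(1) by (simp add: z_def)
    have "poly (map_poly real_of_int (h_poly (interval_subdivision \<Delta>))) (s\<^sup>2)
      = ((1 + s) ^ ?d * ?hb s + (1 - s) ^ ?d * ?hb (- s)) / 2"
      by (rule h_poly_interval_subdivision[OF assms(1) s'(2) s(2)])
    also have "\<dots> = (1 + s\<^sup>2) ^ ?d * ((face_sum K z + face_sum K (- z)) / 2)"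
      unfolding hb[OF s(1)] hbm z_def[symmetric] by (simp add: distrib_left)
    also have "\<dots> = (1 + s\<^sup>2) ^ ?d * face_sum \<Gamma> (z\<^sup>2)"
      unfolding fs face_sum_pair_complex[OF K] ..
    finally show ?thesis unfolding z_def power_divide s'(1) .
  qed
  then have "is_gamma_vector (interval_subdivision \<Delta>) (\<lambda>i. int (fnum \<Gamma> i))"
    using \<Gamma> cdim_interval_subdivision[OF assms(1)]
    by (intro is_gamma_vectorI) (auto simp: simplicial_complex_def)
  then show ?thesis using \<Gamma> cdim_interval_subdivision[OF assms(1)] by auto
qed

end
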